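(* Let $(E_{x,h},E_{y,h},H_{z,h})^T\in C^{1}(0,T;U_{h}^{k})^3$ be a solution of the semi-discrete discontinuous Galerkin scheme (described in the context) for a given current density $\mathbf J_h=(J_{x,h},J_{y,h})\in C(0,T;U_{h}^{k})^2$, with initial values $\mathbf E_h^0=(E_{x,h}^0,E_{y,h}^0)$, $H_{z,h}^0$, and let $\mathcal E_h(t)$ be its nonlinear electromagnetic energy (defined in the context). (i) If the current density vanishes ($\mathbf J_h=0$), then for every $t\in[0,T)$ $$\mathcal{E}_{h}(t)=\mathcal{E}_{h}(0)=\|\mathbf E_h^0\|_{\varepsilon_{0}(1+\chi^{(1)})}^{2}+\|H_{z,h}^{0}\|_{\mu_0}^{2}+\frac{3}{2}\big\||\mathbf E_h^0|^2\big\|_{\varepsilon_{0}\chi^{(3)}}^{2}.$$ (ii) For non-zero current density, for every $t\in[0,T)$ $$\mathcal{E}_h(t)\le 2\mathcal{E}_h(0)+ 8\bigg(\int_{0}^{t}\|\mathbf J_h(s)\|_{(\varepsilon_{0}(1+\chi^{(1)}))^{-1}}\,ds\bigg)^2.$$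
   Context: **Domain and coefficients.** $\Omega=(r,s)\times(p,q)\subset\mathbb R^2$ with $r<s$, $p<q$; $T>0$. $\varepsilon_0>0$ is a constant, and $\mu_0,\chi^{(1)},\chi^{(3)}:\Omega\to(0,\infty)$ belong to $L_\infty(\Omega)$. For a weight $\omega:\Omega\to(0,\infty)$ and a scalar- or vector-valued function $v$ on $\Omega$, $\|v\|_\omega:=\big(\int_\Omega|v|^2\omega\,d\mathbf x\big)^{1/2}$. $C^m(0,T;X)$ denotes $m$ times continuously differentiable functions of $t\in[0,T]$ with values in $X$. **Mesh and space.** Let $r=x_{1/2}<x_{3/2}<\dots<x_{N_x+1/2}=s$ and $p=y_{1/2}<y_{3/2}<\dots<y_{N_y+1/2}=q$, $I_i=(x_{i-1/2},x_{i+1/2})$, $J_j=(y_{j-1/2},y_{j+1/2})$, $K_{ij}=I_i\times J_j$ ($1\le i\le N_x$, $1\le j\le N_y$). For $k\in\mathbb N$, $U_h^k$ is the space of functions on $\Omega$ whose restriction to each $K_{ij}$ lies in $Q_k(K_{ij})$ (tensor products of univariate polynomials of degree at most $k$ in each variable); no continuity across cells is required. Superscripts $+$ and $-$ on a function at $x_{i+1/2}$ (resp. $y_{j+1/2}$) denote the limit from the side of larger, resp. smaller, $x$ (resp. $y$). A subscript $(\cdot)_{x,j+1/2}$ means evaluation at $(x,y_{j+1/2})$, and $(\cdot)_{i+1/2,y}$ means evaluation at $(x_{i+1/2},y)$. **Numerical fluxes.** Fix a constant $c_0>0$ independent of the mesh. Set - $\hat E_{x,h}(x,y_{j+1/2})=E_{x,h}^+(x,y_{j+1/2})$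 for $1\le j\le N_y-1$, and $\hat E_{x,h}(x,y_{1/2})=\hat E_{x,h}(x,y_{N_y+1/2})=0$; - $\hat E_{y,h}(x_{i+1/2},y)=E_{y,h}^+(x_{i+1/2},y)$ for $1\le i\le N_x-1$, and $\hat E_{y,h}(x_{1/2},y)=\hat E_{y,h}(x_{N_x+1/2},y)=0$; - $\hat H_{z,h}(x,y_{j+1/2})=H_{z,h}^-(x,y_{j+1/2})$ for $1\le j\le N_y$, and $\hat H_{z,h}(x,y_{1/2})=H_{z,h}^+(x,y_{1/2})+c_0E_{x,h}^+(x,y_{1/2})$; - $\hat H_{z,h}(x_{i+1/2},y)=H_{z,h}^-(x_{i+1/2},y)$ for $1\le i\le N_x$, and $\hat H_{z,h}(x_{1/2},y)=H_{z,h}^+(x_{1/2},y)-c_0E_{y,h}^+(x_{1/2},y)$. **Semi-discrete scheme.** Write $\mathbf E_h=(E_{x,h},E_{y,h})$, $|\mathbf E_h|^2=E_{x,h}^2+E_{y,h}^2$, and $$\partial_tD_{x,h}:=\varepsilon_0(1+\chi^{(1)})\partial_tE_{x,h}+\varepsilon_0\chi^{(3)}\big[|\mathbf E_h|^2\partial_tE_{x,h}+2E_{x,h}^2\partial_tE_{x,h}+2E_{x,h}E_{y,h}\partial_tE_{y,h}\big],$$ $$\partial_tD_{y,h}:=\varepsilon_0(1+\chi^{(1)})\partial_tE_{y,h}+\varepsilon_0\chi^{(3)}\big[|\mathbf E_h|^2\partial_tE_{y,h}+2E_{y,h}^2\partial_tE_{y,h}+2E_{x,h}E_{y,h}\partial_tE_{x,h}\big].$$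 The scheme requires, for all cells $K_{ij}$, all test functions $\Phi_{1h},\Phi_{2h},\Phi_{3h}\in U_h^k$ and all times, $$\int_{K_{ij}}\partial_tD_{x,h}\Phi_{1h}-\int_{I_i}\big[(\hat H_{z,h}\Phi_{1h}^-)_{x,j+\frac12}-(\hat H_{z,h}\Phi_{1h}^+)_{x,j-\frac12}\big]dx+\int_{K_{ij}}H_{z,h}\partial_y\Phi_{1h}-\int_{K_{ij}}J_{x,h}\Phi_{1h}=0,$$ $$\int_{K_{ij}}\partial_tD_{y,h}\Phi_{2h}+\int_{J_j}\big[(\hat H_{z,h}\Phi_{2h}^-)_{i+\frac12,y}-(\hat H_{z,h}\Phi_{2h}^+)_{i-\frac12,y}\big]dy-\int_{K_{ij}}H_{z,h}\partial_x\Phi_{2h}-\int_{K_{ij}}J_{y,h}\Phi_{2h}=0,$$ $$\int_{K_{ij}}\mu_0\partial_tH_{z,h}\Phi_{3h}+\int_{J_j}\big[(\hat E_{y,h}\Phi_{3h}^-)_{i+\frac12,y}-(\hat E_{y,h}\Phi_{3h}^+)_{i-\frac12,y}\big]dy-\int_{K_{ij}}E_{y,h}\partial_x\Phi_{3h}$$ $$-\int_{I_i}\big[(\hat E_{x,h}\Phi_{3h}^-)_{x,j+\frac12}-(\hat E_{x,h}\Phi_{3h}^+)_{x,j-\frac12}\big]dx+\int_{K_{ij}}E_{x,h}\partial_y\Phi_{3h}=0,$$ together with the initial conditions $E_{x,h}(\cdot,0)=E_{x,h}^0$, $E_{y,h}(\cdot,0)=E_{y,h}^0$, $H_{z,h}(\cdot,0)=H_{z,h}^0$,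 where $E_{x,h}^0,E_{y,h}^0,H_{z,h}^0\in U_h^k$ are given. **Energy.** For $t\in[0,T)$, $$\mathcal E_h(t):=\|\mathbf E_h(t)\|_{\varepsilon_0(1+\chi^{(1)})}^2+\|H_{z,h}(t)\|_{\mu_0}^2+\frac32\big\||\mathbf E_h(t)|^2\big\|_{\varepsilon_0\chi^{(3)}}^2+2c_0\int_0^t\Big[\int_r^s\big(E_{x,h}^+(x,y_{1/2},\tau)\big)^2dx+\int_p^q\big(E_{y,h}^+(x_{1/2},y,\tau)\big)^2dy\Big]d\tau.$$ *)

theory Defs
  imports "HOL-Analysis.Analysis"
begin

text \<open>
  Half-integer mesh indices are shifted: \<open>X i\<close> stands for $x_{i+1/2}$ (\<open>0 \<le> i \<le> Nx\<close>) and
  \<open>Y j\<close> for $y_{j+1/2}$ (\<open>0 \<le> j \<le> Ny\<close>).  Hence the cell with indices \<open>1 \<le> i \<le> Nx\<close>,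
  \<open>1 \<le> j \<le> Ny\<close> lies between \<open>X (i - 1)\<close>, \<open>X i\<close> and \<open>Y (j - 1)\<close>, \<open>Y j\<close>.
  Functions on the rectangle are total functions on \<open>real \<times> real\<close>; their values outside the
  union of the open cells play no role.
\<close>

type_synonym field = "real \<times> real \<Rightarrow> real"

definition grid :: "real \<Rightarrow> real \<Rightarrow> nat \<Rightarrow> (nat \<Rightarrow> real) \<Rightarrow> bool" where
  "grid a b N X \<longleftrightarrow> X 0 = a \<and> X N = b \<and> (\<forall>i<N. X i < X (Suc i))"

definition cell :: "(nat \<Rightarrow> real) \<Rightarrow> (nat \<Rightarrow> real) \<Rightarrow> nat \<Rightarrow> nat \<Rightarrow> (real \<times> real) set" where
  "cell X Y i j = {X (i - 1)<..<X i} \<times> {Y (j - 1)<..<Y j}"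

definition cells :: "nat \<Rightarrow> (nat \<Rightarrow> real) \<Rightarrow> nat \<Rightarrow> (nat \<Rightarrow> real) \<Rightarrow> (real \<times> real) set" where
  "cells Nx X Ny Y = (\<Union>i\<in>{1..Nx}. \<Union>j\<in>{1..Ny}. cell X Y i j)"

definition Q_on :: "nat \<Rightarrow> (real \<times> real) set \<Rightarrow> field set" where
  "Q_on k K = {v. \<exists>c :: nat \<Rightarrow> nat \<Rightarrow> real.
      \<forall>(x, y)\<in>K. v (x, y) = (\<Sum>a\<le>k. \<Sum>b\<le>k. c a b * x ^ a * y ^ b)}"

definition U_h :: "nat \<Rightarrow> nat \<Rightarrow> (nat \<Rightarrow> real) \<Rightarrow> nat \<Rightarrow> (nat \<Rightarrow> real) \<Rightarrow> field set" where
  "U_h k Nx X Ny Y = {v. \<forall>i\<in>{1..Nx}. \<forall>j\<in>{1..Ny}. v \<in> Q_on k (cell X Y i j)}"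

definition L_infty_on :: "(real \<times> real) set \<Rightarrow> field set" where
  "L_infty_on \<Omega> = {f. f \<in> borel_measurable (lebesgue_on \<Omega>) \<and>
      (\<exists>C. AE z in lebesgue_on \<Omega>. \<bar>f z\<bar> \<le> C)}"

definition wnorm ::
  "(real \<times> real) set \<Rightarrow> field \<Rightarrow> (real \<times> real \<Rightarrow> 'b::real_normed_vector) \<Rightarrow> real" where
  "wnorm \<Omega> w v = sqrt (LINT z:\<Omega>|lebesgue. (norm (v z))\<^sup>2 * w z)"

text \<open>
  The space \<open>C_time m T S U\<close> is $C^m(0,T;U)$.  Continuity and differentiability in time refer to
  the sup norm over \<open>S\<close>.  It is used below with \<open>S\<close> the union of the cells and \<open>U\<close> the
  piecewise polynomials, a space of finite dimension once functions are identified that agree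
  on \<open>S\<close>; so every choice of norm gives the same spaces.
\<close>

primrec C_time ::
  "nat \<Rightarrow> real \<Rightarrow> (real \<times> real) set \<Rightarrow> field set \<Rightarrow> (real \<Rightarrow> field) set" where
  "C_time 0 T S U = {u. (\<forall>t\<in>{0..T}. u t \<in> U) \<and>
      (\<forall>t\<in>{0..T}. uniform_limit S u (u t) (at t within {0..T}))}"
| "C_time (Suc m) T S U = {u. (\<forall>t\<in>{0..T}. u t \<in> U) \<and>
      (\<exists>u'\<in>C_time m T S U. \<forall>t\<in>{0..T}.
        uniform_limit S (\<lambda>\<tau> z. (u \<tau> z - u t z) / (\<tau> - t)) (u' t) (at t within {0..T}))}"

text \<open>
  Pointwise partial derivative in time; on the cells it coincides with the derivative \<open>u'\<close>
  in \<open>C_time\<close>.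
\<close>

definition dt :: "real \<Rightarrow> (real \<Rightarrow> field) \<Rightarrow> real \<Rightarrow> field" where
  "dt T u t z = vector_derivative (\<lambda>\<tau>. u \<tau> z) (at t within {0..T})"

definition dx :: "field \<Rightarrow> field" where
  "dx v = (\<lambda>(x, y). deriv (\<lambda>\<xi>. v (\<xi>, y)) x)"

definition dy :: "field \<Rightarrow> field" where
  "dy v = (\<lambda>(x, y). deriv (\<lambda>\<eta>. v (x, \<eta>)) y)"

definition xplus :: "field \<Rightarrow> real \<Rightarrow> real \<Rightarrow> real" where
  "xplus v x y = Lim (at_right x) (\<lambda>\<xi>. v (\<xi>, y))"

definition xminus :: "field \<Rightarrow> real \<Rightarrow> real \<Rightarrow> real" where
  "xminus v x y = Lim (at_left x) (\<lambda>\<xi>. v (\<xi>, y))"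

definition yplus :: "field \<Rightarrow> real \<Rightarrow> real \<Rightarrow> real" where
  "yplus v x y = Lim (at_right y) (\<lambda>\<eta>. v (x, \<eta>))"

definition yminus :: "field \<Rightarrow> real \<Rightarrow> real \<Rightarrow> real" where
  "yminus v x y = Lim (at_left y) (\<lambda>\<eta>. v (x, \<eta>))"

text \<open>
  Numerical fluxes.  The index is that of the mesh line, the last argument the running coordinate:
  \<open>E_x_hat\<close> and \<open>H_z_hat_y\<close> live on the lines \<open>y = Y j\<close>, \<open>E_y_hat\<close> and \<open>H_z_hat_x\<close> on \<open>x = X i\<close>.
\<close>

definition E_x_hat :: "nat \<Rightarrow> (nat \<Rightarrow> real) \<Rightarrow> field \<Rightarrow> nat \<Rightarrow> real \<Rightarrow> real" where
  "E_x_hat Ny Y E_x j x = (if j = 0 \<or> j = Ny then 0 else yplus E_x x (Y j))"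

definition E_y_hat :: "nat \<Rightarrow> (nat \<Rightarrow> real) \<Rightarrow> field \<Rightarrow> nat \<Rightarrow> real \<Rightarrow> real" where
  "E_y_hat Nx X E_y i y = (if i = 0 \<or> i = Nx then 0 else xplus E_y (X i) y)"

definition H_z_hat_y ::
  "real \<Rightarrow> (nat \<Rightarrow> real) \<Rightarrow> field \<Rightarrow> field \<Rightarrow> nat \<Rightarrow> real \<Rightarrow> real" where
  "H_z_hat_y c0 Y H_z E_x j x =
     (if j = 0 then yplus H_z x (Y 0) + c0 * yplus E_x x (Y 0) else yminus H_z x (Y j))"

definition H_z_hat_x ::
  "real \<Rightarrow> (nat \<Rightarrow> real) \<Rightarrow> field \<Rightarrow> field \<Rightarrow> nat \<Rightarrow> real \<Rightarrow> real" where
  "H_z_hat_x c0 X H_z E_y i y =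
     (if i = 0 then xplus H_z (X 0) y - c0 * xplus E_y (X 0) y else xminus H_z (X i) y)"

text \<open>
  Time derivative of the component, in direction of \<open>A\<close>, of the electric displacement; \<open>B\<close> is the
  other component of the electric field and \<open>A'\<close>, \<open>B'\<close> are the time derivatives of \<open>A\<close>, \<open>B\<close>.
\<close>

definition dtD ::
  "real \<Rightarrow> field \<Rightarrow> field \<Rightarrow> field \<Rightarrow> field \<Rightarrow> field \<Rightarrow> field \<Rightarrow> field" where
  "dtD eps0 chi1 chi3 A B A' B' z =
     eps0 * (1 + chi1 z) * A' z
     + eps0 * chi3 z * (((A z)\<^sup>2 + (B z)\<^sup>2) * A' z + 2 * (A z)\<^sup>2 * A' z + 2 * A z * B z * B' z)"

definition dg_scheme ::
  "nat \<Rightarrow> nat \<Rightarrow> (nat \<Rightarrow> real) \<Rightarrow> nat \<Rightarrow> (nat \<Rightarrow> real) \<Rightarrow> real \<Rightarrow>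
   real \<Rightarrow> field \<Rightarrow> field \<Rightarrow> field \<Rightarrow> real \<Rightarrow>
   (real \<Rightarrow> field) \<Rightarrow> (real \<Rightarrow> field) \<Rightarrow>
   (real \<Rightarrow> field) \<Rightarrow> (real \<Rightarrow> field) \<Rightarrow> (real \<Rightarrow> field) \<Rightarrow> bool" where
  "dg_scheme k Nx X Ny Y T eps0 mu0 chi1 chi3 c0 J_x J_y E_x E_y H_z \<longleftrightarrow>
    (\<forall>t\<in>{0..T}. \<forall>i\<in>{1..Nx}. \<forall>j\<in>{1..Ny}.
      \<forall>\<Phi>1\<in>U_h k Nx X Ny Y. \<forall>\<Phi>2\<in>U_h k Nx X Ny Y. \<forall>\<Phi>3\<in>U_h k Nx X Ny Y.
      let K = cell X Y i j; I = {X (i - 1)<..<X i}; J = {Y (j - 1)<..<Y j} in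
      (LINT z:K|lebesgue. dtD eps0 chi1 chi3 (E_x t) (E_y t) (dt T E_x t) (dt T E_y t) z * \<Phi>1 z)
      - (LINT x:I|lebesgue.
           H_z_hat_y c0 Y (H_z t) (E_x t) j x * yminus \<Phi>1 x (Y j)
           - H_z_hat_y c0 Y (H_z t) (E_x t) (j - 1) x * yplus \<Phi>1 x (Y (j - 1)))
      + (LINT z:K|lebesgue. H_z t z * dy \<Phi>1 z)
      - (LINT z:K|lebesgue. J_x t z * \<Phi>1 z) = 0
      \<and>
      (LINT z:K|lebesgue. dtD eps0 chi1 chi3 (E_y t) (E_x t) (dt T E_y t) (dt T E_x t) z * \<Phi>2 z)
      + (LINT y:J|lebesgue.
           H_z_hat_x c0 X (H_z t) (E_y t) i y * xminus \<Phi>2 (X i) y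
           - H_z_hat_x c0 X (H_z t) (E_y t) (i - 1) y * xplus \<Phi>2 (X (i - 1)) y)
      - (LINT z:K|lebesgue. H_z t z * dx \<Phi>2 z)
      - (LINT z:K|lebesgue. J_y t z * \<Phi>2 z) = 0
      \<and>
      (LINT z:K|lebesgue. mu0 z * dt T H_z t z * \<Phi>3 z)
      + (LINT y:J|lebesgue.
           E_y_hat Nx X (E_y t) i y * xminus \<Phi>3 (X i) y
           - E_y_hat Nx X (E_y t) (i - 1) y * xplus \<Phi>3 (X (i - 1)) y)
      - (LINT z:K|lebesgue. E_y t z * dx \<Phi>3 z)
      - (LINT x:I|lebesgue.
           E_x_hat Ny Y (E_x t) j x * yminus \<Phi>3 x (Y j)
           - E_x_hat Ny Y (E_x t) (j - 1) x * yplus \<Phi>3 x (Y (j - 1)))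
      + (LINT z:K|lebesgue. E_x t z * dy \<Phi>3 z) = 0)"

definition energy ::
  "real \<Rightarrow> real \<Rightarrow> real \<Rightarrow> real \<Rightarrow> real \<Rightarrow> field \<Rightarrow> field \<Rightarrow> field \<Rightarrow> real \<Rightarrow>
   (real \<Rightarrow> field) \<Rightarrow> (real \<Rightarrow> field) \<Rightarrow> (real \<Rightarrow> field) \<Rightarrow> real \<Rightarrow> real" where
  "energy r s p q eps0 mu0 chi1 chi3 c0 E_x E_y H_z t =
    (let \<Omega> = {r<..<s} \<times> {p<..<q} in
     (wnorm \<Omega> (\<lambda>z. eps0 * (1 + chi1 z)) (\<lambda>z. (E_x t z, E_y t z)))\<^sup>2
     + (wnorm \<Omega> mu0 (H_z t))\<^sup>2
     + 3 / 2 * (wnorm \<Omega> (\<lambda>z. eps0 * chi3 z) (\<lambda>z. (E_x t z)\<^sup>2 + (E_y t z)\<^sup>2))\<^sup>2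
     + 2 * c0 * (LINT \<tau>:{0..t}|lebesgue.
         (LINT x:{r<..<s}|lebesgue. (yplus (E_x \<tau>) x p)\<^sup>2)
         + (LINT y:{p<..<q}|lebesgue. (xplus (E_y \<tau>) r y)\<^sup>2)))"

end

theory Submission
  imports Defs
begin

text \<open>
  Testing the three equations with \<open>E_x\<close>, \<open>E_y\<close>, \<open>H_z\<close> and adding them, the volume terms
  \<open>H \<partial>E + E \<partial>H\<close> of each cell integrate to traces on its edges.  With the alternating fluxes
  these traces telescope across every interior edge, and only the penalty terms
  \<open>c0 E\<^sup>2\<close> on the lines \<open>y = p\<close> and \<open>x = r\<close> remain.  The nonlinear part of \<open>\<partial>\<^sub>t D\<close> tested with \<open>E\<close> is
  \<open>3 \<bar>E\<bar>\<^sup>2 E \<cdot> \<partial>\<^sub>t E\<close>, which is the time derivative of \<open>3/4 \<bar>E\<bar>\<^sup>4\<close>; hence the energy has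
  derivative \<open>2 \<integral> J \<cdot> E\<close>.  Without current it is constant.  Otherwise let \<open>M\<close> be its maximum over
  \<open>[0, t]\<close>; the Cauchy-Schwarz inequality gives \<open>M \<le> \<E>(0) + 2 \<surd>M \<integral> \<parallel>J\<parallel>\<close>, and Young's inequality
  absorbs \<open>\<surd>M\<close>.
\<close>

subsection \<open>Uniform continuity and differentiability in time\<close>

text \<open>The coefficients are merely bounded and measurable, so the energy is differentiated as a
  sum of integrals of fields against fixed integrable weights, and uniform convergence in time
  carries the limit under the integral. The quartic energy density leaves the polynomial space; the
  calculus in time therefore lives in a class closed under products, bounded measurable functions.
  Traces are one-sided limits and space derivatives are \<open>deriv\<close>; on each open cell both
  are computed from a polynomial on the whole plane that agrees with the field there. Since nothing
  is known about the fields on the mesh lines, every integral over the rectangle is first moved to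
  the union of the open cells. The last term of the energy is what turns the dissipation by the
  penalties into an exact identity for the derivative. Dividing that identity by the square root of
  the energy would fail where the energy vanishes; evaluating at a maximum avoids the division and
  produces the constants 2 and 4.\<close>

definition bmeas :: "'a::euclidean_space set \<Rightarrow> ('a \<Rightarrow> real) \<Rightarrow> bool" where
  "bmeas S f \<longleftrightarrow> f \<in> borel_measurable (lebesgue_on S) \<and> bounded (f ` S)"

lemma bmeas_bounded: "bmeas S f \<Longrightarrow> bounded (f ` S)"
  by (simp add: bmeas_def)

lemma bmeas_const: "bmeas S (\<lambda>z. c)"
  by (auto simp: bmeas_def bounded_iff)

lemma bmeas_add: "bmeas S f \<Longrightarrow> bmeas S g \<Longrightarrow> bmeas S (\<lambda>z. f z + g z)"
  by (simp add: bmeas_def bounded_plus_comp borel_measurable_add)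

lemma bmeas_mult:
  assumes f: "bmeas S f" and g: "bmeas S g"
  shows "bmeas S (\<lambda>z. f z * g z)"
proof -
  obtain a b where "\<And>z. z \<in> S \<Longrightarrow> \<bar>f z\<bar> \<le> a" "\<And>z. z \<in> S \<Longrightarrow> \<bar>g z\<bar> \<le> b"
    using f g by (force simp: bmeas_def bounded_iff)
  then have "\<bar>f z * g z\<bar> \<le> a * b" if "z \<in> S" for z
    unfolding abs_mult by (rule mult_mono') (simp_all add: that)
  then have "bounded ((\<lambda>z. f z * g z) ` S)"
    unfolding bounded_iff by (intro exI[of _ "a * b"]) simp
  then show ?thesis
    using f g by (simp add: bmeas_def borel_measurable_times)
qed

lemma bmeas_cong:
  assumes "bmeas S f" "\<And>z. z \<in> S \<Longrightarrow> f z = g z"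
  shows "bmeas S g"
proof -
  have "g ` S = f ` S"
    using assms(2) by (simp cong: image_cong)
  moreover have "f \<in> borel_measurable (lebesgue_on S) \<longleftrightarrow> g \<in> borel_measurable (lebesgue_on S)"
    using assms(2) by (intro measurable_cong) simp
  ultimately show ?thesis
    using assms(1) by (simp add: bmeas_def)
qed

lemma bmeas_weighted_integrable:
  assumes "bmeas S f" "set_integrable lebesgue S w" "S \<in> sets lebesgue"
  shows "set_integrable lebesgue S (\<lambda>z. f z * w z)"
  using assms unfolding bmeas_def
  by (intro absolutely_integrable_bounded_measurable_product[OF bilinear_times]) simp_all

definition ucont :: "real \<Rightarrow> 'a::euclidean_space set \<Rightarrow> (real \<Rightarrow> 'a \<Rightarrow> real) \<Rightarrow> bool" where
  "ucont T S u \<longleftrightarrow> (\<forall>t\<in>{0..T}. bmeas S (u t) \<and> uniform_limit S u (u t) (at t within {0..T}))"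

text \<open>The derivative is only asked to be bounded and measurable, not to lie in the discrete
  space: products of piecewise polynomials exceed the degree \<open>k\<close>, and the product rule
  must stay inside the notion. The domain is any Euclidean space because the calculus serves the
  cells in the plane as well as the mesh intervals on the boundary (there through
  \<open>ucont\<close>).\<close>

definition udiff ::
  "real \<Rightarrow> 'a::euclidean_space set \<Rightarrow> (real \<Rightarrow> 'a \<Rightarrow> real) \<Rightarrow> (real \<Rightarrow> 'a \<Rightarrow> real) \<Rightarrow> bool" where
  "udiff T S u u' \<longleftrightarrow> (\<forall>t\<in>{0..T}. bmeas S (u t) \<and> bmeas S (u' t) \<and>
      uniform_limit S (\<lambda>\<tau> z. (u \<tau> z - u t z) / (\<tau> - t)) (u' t) (at t within {0..T}))"

lemma ucont_add: "ucont T S u \<Longrightarrow> ucont T S v \<Longrightarrow> ucont T S (\<lambda>t z. u t z + v t z)"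
  by (simp add: ucont_def bmeas_add uniform_limit_add)

lemma ucont_mult: "ucont T S u \<Longrightarrow> ucont T S v \<Longrightarrow> ucont T S (\<lambda>t z. u t z * v t z)"
  by (simp add: ucont_def bmeas_mult uniform_lim_mult bmeas_bounded)

lemma udiff_imp_ucont:
  assumes "udiff T S u u'"
  shows "ucont T S u"
  unfolding ucont_def
proof
  fix t assume t: "t \<in> {0..T}"
  let ?F = "at t within {0..T}"
  have lim: "uniform_limit S (\<lambda>\<tau> z. (u \<tau> z - u t z) / (\<tau> - t)) (u' t) ?F"
    and bu': "bounded (u' t ` S)" and bu: "bmeas S (u t)"
    using assms t by (auto simp: udiff_def bmeas_def)
  have id: "uniform_limit S (\<lambda>\<tau> z. \<tau> - t) (\<lambda>z. 0) ?F"
    by (rule uniform_limitI, simp add: dist_real_def, unfold eventually_at dist_real_def) blast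
  have b0: "bounded ((\<lambda>z. 0::real) ` S)"
    by (auto simp: bounded_iff)
  have "uniform_limit S (\<lambda>\<tau> z. (u \<tau> z - u t z) / (\<tau> - t) * (\<tau> - t) + u t z)
          (\<lambda>z. u' t z * 0 + u t z) ?F"
    by (intro uniform_limit_intros uniform_lim_mult lim id bu' b0)
  then have "uniform_limit S u (u t) ?F"
    by (rule uniform_limit_cong[THEN iffD1, rotated 2]) (auto simp: eventually_at_filter)
  then show "bmeas S (u t) \<and> uniform_limit S u (u t) ?F"
    using bu by simp
qed

lemma udiff_add:
  assumes "udiff T S u u'" "udiff T S v v'"
  shows "udiff T S (\<lambda>t z. u t z + v t z) (\<lambda>t z. u' t z + v' t z)"
  unfolding udiff_def
proof (intro ballI conjI)
  fix t assume t: "t \<in> {0..T}"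
  have "uniform_limit S (\<lambda>\<tau> z. (u \<tau> z - u t z) / (\<tau> - t) + (v \<tau> z - v t z) / (\<tau> - t))
     (\<lambda>z. u' t z + v' t z) (at t within {0..T})"
    using assms t by (intro uniform_limit_intros) (auto simp: udiff_def)
  then show "uniform_limit S (\<lambda>\<tau> z. (u \<tau> z + v \<tau> z - (u t z + v t z)) / (\<tau> - t))
     (\<lambda>z. u' t z + v' t z) (at t within {0..T})"
    by (simp add: add_divide_distrib[symmetric] add_diff_add)
qed (use assms in \<open>auto simp: udiff_def intro: bmeas_add\<close>)

lemma udiff_mult:
  assumes u: "udiff T S u u'" and v: "udiff T S v v'"
  shows "udiff T S (\<lambda>t z. u t z * v t z) (\<lambda>t z. u' t z * v t z + u t z * v' t z)"
  unfolding udiff_def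
proof (intro ballI conjI)
  fix t assume t: "t \<in> {0..T}"
  have *: "(a * b - a0 * b0) / d = (a - a0) / d * b + a0 * ((b - b0) / d)" for a b a0 b0 d :: real
    by (simp add: diff_divide_distrib left_diff_distrib right_diff_distrib)
  have vlim: "uniform_limit S v (v t) (at t within {0..T})"
    using udiff_imp_ucont[OF v] t by (simp add: ucont_def)
  have "uniform_limit S
     (\<lambda>\<tau> z. (u \<tau> z - u t z) / (\<tau> - t) * v \<tau> z + u t z * ((v \<tau> z - v t z) / (\<tau> - t)))
     (\<lambda>z. u' t z * v t z + u t z * v' t z) (at t within {0..T})"
    by (rule uniform_limit_add[OF uniform_lim_mult uniform_lim_mult])
      (use u v t vlim in \<open>simp_all add: udiff_def bmeas_def uniform_limit_const\<close>)
  then show "uniform_limit S (\<lambda>\<tau> z. (u \<tau> z * v \<tau> z - u t z * v t z) / (\<tau> - t))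
     (\<lambda>z. u' t z * v t z + u t z * v' t z) (at t within {0..T})"
    by (simp only: *)
qed (use u v in \<open>simp_all add: udiff_def bmeas_add bmeas_mult\<close>)

text \<open>If \<open>g \<tau>\<close> is within \<open>d\<close> of \<open>l\<close> uniformly on
  \<open>S\<close>, the integrals differ by at most \<open>d\<close> times the integral of
  \<open>\<bar>w\<bar>\<close>. No dominating function is required, and the same estimate serves for
  values and for difference quotients in time.\<close>

lemma tendsto_weighted_integral:
  assumes lim: "uniform_limit S g l F"
    and g: "\<forall>\<^sub>F \<tau> in F. bmeas S (g \<tau>)" and l: "bmeas S l"
    and w: "set_integrable lebesgue S w" and S: "S \<in> sets lebesgue"
  shows "((\<lambda>\<tau>. LINT z:S|lebesgue. g \<tau> z * w z) \<longlongrightarrow> (LINT z:S|lebesgue. l z * w z)) F"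
proof (rule tendstoI)
  fix e :: real assume e: "e > 0"
  define W where "W = (LINT z:S|lebesgue. \<bar>w z\<bar>)"
  have W: "W \<ge> 0"
    unfolding W_def set_lebesgue_integral_def by (rule Bochner_Integration.integral_nonneg) simp
  \<comment> \<open>\<open>W\<close> may be 0; adding 1 keeps the quotient defined and makes
    \<open>d * W < e\<close> strict.\<close>
  define d where "d = e / (W + 1)"
  have d: "d > 0" "d * W < e"
    using e W by (auto simp: d_def field_simps)
  have "\<forall>\<^sub>F \<tau> in F. \<forall>z\<in>S. dist (g \<tau> z) (l z) < d"
    by (rule uniform_limitD[OF lim d(1)])
  with g show "\<forall>\<^sub>F \<tau> in F. dist (LINT z:S|lebesgue. g \<tau> z * w z) (LINT z:S|lebesgue. l z * w z) < e"
  proof eventually_elim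
    case (elim \<tau>)
    have i: "set_integrable lebesgue S (\<lambda>z. g \<tau> z * w z)" "set_integrable lebesgue S (\<lambda>z. l z * w z)"
      using elim l w S by (auto intro: bmeas_weighted_integrable)
    have "dist (LINT z:S|lebesgue. g \<tau> z * w z) (LINT z:S|lebesgue. l z * w z)
        = norm (LINT z:S|lebesgue. g \<tau> z * w z - l z * w z)"
      using i by (simp add: dist_norm)
    also have "\<dots> \<le> (LINT z:S|lebesgue. norm (g \<tau> z * w z - l z * w z))"
      using i by (intro set_integral_norm_bound) auto
    also have "\<dots> \<le> (LINT z:S|lebesgue. d * \<bar>w z\<bar>)"
    proof (rule set_integral_mono)
      fix z assume "z \<in> S"
      then have "\<bar>g \<tau> z - l z\<bar> \<le> d"
        using elim by (force simp: dist_real_def)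
      then show "norm (g \<tau> z * w z - l z * w z) \<le> d * \<bar>w z\<bar>"
        by (simp add: left_diff_distrib[symmetric] abs_mult mult_right_mono)
    qed (use i w in \<open>auto intro!: set_integrable_abs\<close>)
    also have "\<dots> = d * W"
      by (simp add: W_def)
    finally show ?case
      using d by simp
  qed
qed

lemma ucont_weighted_integral_continuous:
  assumes "ucont T S u" "set_integrable lebesgue S w" "S \<in> sets lebesgue"
  shows "continuous_on {0..T} (\<lambda>t. LINT z:S|lebesgue. u t z * w z)"
  unfolding continuous_on_def
proof
  fix t assume t: "t \<in> {0..T}"
  have "\<forall>\<^sub>F \<tau> in at t within {0..T}. bmeas S (u \<tau>)"
    using assms(1) by (simp add: ucont_def eventually_at_filter)
  then show "((\<lambda>t. LINT z:S|lebesgue. u t z * w z) \<longlongrightarrow> (LINT z:S|lebesgue. u t z * w z))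
      (at t within {0..T})"
    using assms t by (intro tendsto_weighted_integral) (simp_all add: ucont_def)
qed

lemma udiff_weighted_integral_derivative:
  assumes u: "udiff T S u u'" and w: "set_integrable lebesgue S w" "S \<in> sets lebesgue"
    and t: "t \<in> {0..T}"
  shows "((\<lambda>t. LINT z:S|lebesgue. u t z * w z) has_real_derivative
    (LINT z:S|lebesgue. u' t z * w z)) (at t within {0..T})"
proof -
  have b: "bmeas S (\<lambda>z. (u \<tau> z - u t z) / (\<tau> - t))" if "\<tau> \<in> {0..T}" for \<tau>
  proof -
    have "bmeas S (\<lambda>z. (1 / (\<tau> - t)) * (u \<tau> z + (-1) * u t z))"
      using u t that by (intro bmeas_mult bmeas_add bmeas_const) (auto simp: udiff_def)
    then show ?thesis by simp
  qed
  have "\<forall>\<^sub>F \<tau> in at t within {0..T}. bmeas S (\<lambda>z. (u \<tau> z - u t z) / (\<tau> - t))"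
    using b by (simp add: eventually_at_filter)
  then have "((\<lambda>\<tau>. LINT z:S|lebesgue. (u \<tau> z - u t z) / (\<tau> - t) * w z) \<longlongrightarrow>
      (LINT z:S|lebesgue. u' t z * w z)) (at t within {0..T})"
    using u t by (intro tendsto_weighted_integral w) (simp_all add: udiff_def)
  then have "((\<lambda>\<tau>. ((LINT z:S|lebesgue. u \<tau> z * w z) - (LINT z:S|lebesgue. u t z * w z)) / (\<tau> - t))
      \<longlongrightarrow> (LINT z:S|lebesgue. u' t z * w z)) (at t within {0..T})"
  proof (rule Lim_transform_eventually)
    have "(LINT z:S|lebesgue. (u \<tau> z - u t z) / (\<tau> - t) * w z) =
      ((LINT z:S|lebesgue. u \<tau> z * w z) - (LINT z:S|lebesgue. u t z * w z)) / (\<tau> - t)"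
      if \<tau>: "\<tau> \<in> {0..T}" for \<tau>
    proof -
      have "set_integrable lebesgue S (\<lambda>z. u \<tau> z * w z)" "set_integrable lebesgue S (\<lambda>z. u t z * w z)"
        using u t \<tau> by (simp_all add: udiff_def bmeas_weighted_integrable w)
      from set_integral_diff(2)[OF this] show ?thesis
        by (simp add: left_diff_distrib)
    qed
    then show "\<forall>\<^sub>F \<tau> in at t within {0..T}. (LINT z:S|lebesgue. (u \<tau> z - u t z) / (\<tau> - t) * w z) =
      ((LINT z:S|lebesgue. u \<tau> z * w z) - (LINT z:S|lebesgue. u t z * w z)) / (\<tau> - t)"
      unfolding eventually_at_filter by (intro always_eventually) blast
  qed
  then show ?thesis
    by (simp add: has_field_derivative_iff)
qed

text \<open>Lebesgue measure is complete, so arbitrary values on a null set affect neither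
  integrability nor the integral. This allows passing from the rectangle to the open cells for every
  \<open>f\<close>, without any assumption on its values on the mesh lines.\<close>

lemma set_lebesgue_integral_null_diff:
  fixes f :: "'a::euclidean_space \<Rightarrow> real"
  assumes "S \<subseteq> \<Omega>" "negligible (\<Omega> - S)"
  shows "(LINT z:\<Omega>|lebesgue. f z) = (LINT z:S|lebesgue. f z)"
    and "set_integrable lebesgue \<Omega> f \<longleftrightarrow> set_integrable lebesgue S f"
proof -
  have n: "negligible {z \<in> S - \<Omega>. f z \<noteq> 0}" "negligible {z \<in> \<Omega> - S. f z \<noteq> 0}"
    using assms by (auto intro: negligible_subset)
  show *: "set_integrable lebesgue \<Omega> f \<longleftrightarrow> set_integrable lebesgue S f"
    using absolutely_integrable_spike_set_eq[OF n] by simp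
  show "(LINT z:\<Omega>|lebesgue. f z) = (LINT z:S|lebesgue. f z)"
  proof (cases "set_integrable lebesgue S f")
    case True
    then show ?thesis
      using * n by (auto simp: set_lebesgue_integral_eq_integral(2) intro!: integral_spike_set)
  next
    \<comment> \<open>Both integrals then have the default value 0 of the Bochner integral.\<close>
    case False
    then show ?thesis
      using * by (simp add: set_integrable_def set_lebesgue_integral_def not_integrable_integral_eq)
  qed
qed

lemma L_infty_on_integrable:
  assumes "f \<in> L_infty_on \<Omega>" "\<Omega> \<in> lmeasurable"
  shows "set_integrable lebesgue \<Omega> f"
proof -
  have "finite_measure (lebesgue_on \<Omega>)"
    using assms(2) by (rule finite_measure_lebesgue_on)
  moreover obtain C where "AE z in lebesgue_on \<Omega>. \<bar>f z\<bar> \<le> C" "f \<in> borel_measurable (lebesgue_on \<Omega>)"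
    using assms(1) by (auto simp: L_infty_on_def)
  ultimately have "integrable (lebesgue_on \<Omega>) f"
    by (intro finite_measure.integrable_const_bound[where B = C]) auto
  then show ?thesis
    using assms(2) by (simp add: set_integrable_def integrable_restrict_space fmeasurableD)
qed

subsection \<open>Meshes and piecewise polynomials\<close>

text \<open>The one-dimensional counterpart of \<open>cells\<close>: the union of the open intervals
  between consecutive nodes, so that \<open>cells\<close> becomes a product of two such
  sets.\<close>

definition lines :: "nat \<Rightarrow> (nat \<Rightarrow> real) \<Rightarrow> real set" where
  "lines N X = (\<Union>i\<in>{1..N}. {X (i - 1)<..<X i})"

lemma cells_eq_Times: "cells Nx X Ny Y = lines Nx X \<times> lines Ny Y"
  by (auto simp: cells_def lines_def cell_def)

lemma grid_mono:
  assumes "grid a b N X" "i \<le> j" "j \<le> N"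
  shows "X i \<le> X j"
  using assms(2,3)
proof (induction j rule: dec_induct)
  case (step j)
  then have "X j \<le> X (Suc j)"
    using assms(1) by (simp add: grid_def less_imp_le)
  then show ?case
    using step by linarith
qed simp

lemma grid_less:
  assumes "grid a b N X" "i \<in> {1..N}"
  shows "X (i - 1) < X i"
  using assms by (cases i) (auto simp: grid_def)

lemma grid_pos:
  assumes "grid a b N X" "a < b"
  shows "N \<ge> 1"
  using assms by (cases N) (auto simp: grid_def)

lemma lines_subset:
  assumes "grid a b N X"
  shows "lines N X \<subseteq> {a<..<b}"
proof
  fix x assume "x \<in> lines N X"
  then obtain i where i: "i \<in> {1..N}" "X (i - 1) < x" "x < X i"
    by (auto simp: lines_def)
  have "X 0 \<le> X (i - 1)" "X i \<le> X N"
    using i by (auto intro!: grid_mono[OF assms])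
  then show "x \<in> {a<..<b}"
    using i assms by (auto simp: grid_def)
qed

lemma lines_cover:
  assumes "grid a b N X" "x \<in> {a<..<b}" "x \<notin> X ` {..N}"
  shows "x \<in> lines N X"
proof -
  \<comment> \<open>Induction on the number of leading intervals: either \<open>x\<close> is already
    below the previous node, or, not being a node itself, it lies in the newest interval.\<close>
  have "\<exists>i\<in>{1..n}. X (i - 1) < x \<and> x < X i" if "n \<le> N" "x < X n" for n
    using that
  proof (induction n)
    case 0
    then show ?case
      using assms by (auto simp: grid_def)
  next
    case (Suc n)
    show ?case
    proof (cases "x < X n")
      case True
      then show ?thesis
        using Suc by force
    next
      case False
      then have "X n < x"
        using Suc.prems assms(3) by (metis atMost_iff image_eqI linorder_neqE_linordered_idom Suc_leD)
      then show ?thesis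
        using Suc.prems by (intro bexI[of _ "Suc n"]) auto
    qed
  qed
  from this[of N] show ?thesis
    using assms by (auto simp: grid_def lines_def)
qed

lemma open_lines: "open (lines N X)"
  by (auto simp: lines_def)

lemma open_cells: "open (cells Nx X Ny Y)"
  by (simp add: cells_eq_Times open_Times open_lines)

lemma negligible_lines:
  assumes "grid a b N X"
  shows "negligible ({a<..<b} - lines N X)"
proof (rule negligible_subset)
  show "{a<..<b} - lines N X \<subseteq> X ` {..N}"
    using lines_cover[OF assms] by blast
qed (simp add: negligible_finite)

lemma negligible_cells:
  assumes "grid r s Nx X" "grid p q Ny Y"
  shows "negligible ({r<..<s} \<times> {p<..<q} - cells Nx X Ny Y)"
proof (rule negligible_subset)
  let ?A = "(\<Union>i\<in>{..Nx}. {z::real \<times> real. z \<bullet> (1, 0) = X i}) \<union> (\<Union>j\<in>{..Ny}. {z::real \<times> real. z \<bullet> (0, 1) = Y j})"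
  show "negligible ?A"
    by (auto intro!: negligible_standard_hyperplane simp: Basis_prod_def)
  show "{r<..<s} \<times> {p<..<q} - cells Nx X Ny Y \<subseteq> ?A"
  proof
    fix z assume z: "z \<in> {r<..<s} \<times> {p<..<q} - cells Nx X Ny Y"
    then have "fst z \<notin> lines Nx X \<or> snd z \<notin> lines Ny Y"
      by (auto simp: cells_eq_Times)
    then have "fst z \<in> X ` {..Nx} \<or> snd z \<in> Y ` {..Ny}"
      using lines_cover[OF assms(1)] lines_cover[OF assms(2)] z by auto
    then show "z \<in> ?A"
      by (cases z) auto
  qed
qed

lemma disjoint_lines:
  assumes "grid a b N X"
  shows "disjoint_family_on (\<lambda>i. {X (i - 1)<..<X i}) {1..N}"
proof -
  have "{X (i - 1)<..<X i} \<inter> {X (j - 1)<..<X j} = {}" if "i < j" "j \<in> {1..N}" for i j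
  proof -
    have "X i \<le> X (j - 1)"
      using that by (intro grid_mono[OF assms]) auto
    then show ?thesis
      by (auto simp: not_less min.coboundedI1 max.coboundedI2)
  qed
  then show ?thesis
    unfolding disjoint_family_on_def by (metis Int_commute linorder_neqE_nat)
qed

lemma integral_lines:
  fixes f :: "real \<Rightarrow> real"
  assumes "grid a b N X" "\<And>i. i \<in> {1..N} \<Longrightarrow> set_integrable lebesgue {X (i - 1)<..<X i} f"
  shows "(LINT x:{a<..<b}|lebesgue. f x) = (\<Sum>i\<in>{1..N}. LINT x:{X (i - 1)<..<X i}|lebesgue. f x)"
proof -
  have "(LINT x:{a<..<b}|lebesgue. f x) = (LINT x:lines N X|lebesgue. f x)"
    using assms(1) by (intro set_lebesgue_integral_null_diff lines_subset negligible_lines)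
  also have "\<dots> = (\<Sum>i\<in>{1..N}. LINT x:{X (i - 1)<..<X i}|lebesgue. f x)"
    unfolding lines_def using assms
    by (intro set_integral_finite_Union disjoint_lines) auto
  finally show ?thesis .
qed

lemma open_cell: "open (cell X Y i j)"
  by (simp add: cell_def open_Times)

lemma cell_sets: "cell X Y i j \<in> sets lebesgue"
  using open_cell by (intro sets_completionI_sets) (simp add: borel_open)

lemma integral_cells:
  fixes f :: field
  assumes "grid r s Nx X" "grid p q Ny Y" "set_integrable lebesgue (cells Nx X Ny Y) f"
  shows "(LINT z:cells Nx X Ny Y|lebesgue. f z) =
    (\<Sum>i\<in>{1..Nx}. \<Sum>j\<in>{1..Ny}. LINT z:cell X Y i j|lebesgue. f z)"
proof -
  have cell: "set_integrable lebesgue (cell X Y i j) f" if "i \<in> {1..Nx}" "j \<in> {1..Ny}" for i j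
    using assms(3) by (rule set_integrable_subset) (use that cell_sets in \<open>unfold cells_def, blast+\<close>)
  have "disjoint_family_on (\<lambda>(i, j). cell X Y i j) ({1..Nx} \<times> {1..Ny})"
    using disjoint_lines[OF assms(1)] disjoint_lines[OF assms(2)]
    unfolding disjoint_family_on_def cell_def by fastforce
  moreover have "cells Nx X Ny Y = (\<Union>(i, j)\<in>{1..Nx} \<times> {1..Ny}. cell X Y i j)"
    by (auto simp: cells_def)
  ultimately have "(LINT z:cells Nx X Ny Y|lebesgue. f z) =
      (\<Sum>m\<in>{1..Nx} \<times> {1..Ny}. LINT z:(case m of (i, j) \<Rightarrow> cell X Y i j)|lebesgue. f z)"
    using cell cell_sets by (simp only:) (rule set_integral_finite_Union, auto)
  also have "\<dots> = (\<Sum>i\<in>{1..Nx}. \<Sum>j\<in>{1..Ny}. LINT z:cell X Y i j|lebesgue. f z)"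
    by (simp add: sum.cartesian_product split_def)
  finally show ?thesis .
qed

text \<open>The polynomial itself is the extension. Being continuous on the whole plane, it supplies
  the traces on the edges of an open cell and integrability up to the boundary. Only the derivative
  in \<open>y\<close> is recorded, since the \<open>x\<close> direction is reached by exchanging the
  coordinates.\<close>

lemma Q_on_extension:
  assumes "v \<in> Q_on k K"
  obtains P Py where "continuous_on UNIV P" "continuous_on UNIV Py"
    "\<And>x y. ((\<lambda>\<eta>. P (x, \<eta>)) has_real_derivative Py (x, y)) (at y)"
    "\<And>z. z \<in> K \<Longrightarrow> v z = P z"
proof -
  obtain c :: "nat \<Rightarrow> nat \<Rightarrow> real"
    where c: "\<forall>(x, y)\<in>K. v (x, y) = (\<Sum>a\<le>k. \<Sum>b\<le>k. c a b * x ^ a * y ^ b)"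
    using assms by (auto simp: Q_on_def)
  define P where "P = (\<lambda>z::real \<times> real. \<Sum>a\<le>k. \<Sum>b\<le>k. c a b * fst z ^ a * snd z ^ b)"
  define Py where
    "Py = (\<lambda>z::real \<times> real. \<Sum>a\<le>k. \<Sum>b\<le>k. c a b * fst z ^ a * (real b * snd z ^ (b - Suc 0)))"
  show ?thesis
  proof
    show "continuous_on UNIV P" "continuous_on UNIV Py"
      unfolding P_def Py_def by (intro continuous_intros)+
    show "((\<lambda>\<eta>. P (x, \<eta>)) has_real_derivative Py (x, y)) (at y)" for x y
      unfolding P_def Py_def fst_conv snd_conv
      by (intro DERIV_sum DERIV_cmult DERIV_pow)
    show "v z = P z" if "z \<in> K" for z
      using c that by (cases z) (auto simp: P_def)
  qed
qed

text \<open>The degree bound \<open>k\<close> is the same in both variables, so exchanging the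
  coordinates only transposes the coefficient matrix.\<close>

lemma Q_on_swap:
  assumes "v \<in> Q_on k K"
  shows "v \<circ> prod.swap \<in> Q_on k (prod.swap ` K)"
proof -
  obtain c :: "nat \<Rightarrow> nat \<Rightarrow> real"
    where c: "\<forall>(x, y)\<in>K. v (x, y) = (\<Sum>a\<le>k. \<Sum>b\<le>k. c a b * x ^ a * y ^ b)"
    using assms by (auto simp: Q_on_def)
  have "(v \<circ> prod.swap) (y, x) = (\<Sum>b\<le>k. \<Sum>a\<le>k. c a b * y ^ b * x ^ a)" if "(x, y) \<in> K" for x y
    using c that sum.swap[of "\<lambda>a b. c a b * x ^ a * y ^ b" "{..k}" "{..k}"]
    by (auto simp: mult.assoc mult.commute[of "x ^ _"])
  then have "\<forall>(y, x)\<in>prod.swap ` K.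
      (v \<circ> prod.swap) (y, x) = (\<Sum>b\<le>k. \<Sum>a\<le>k. (\<lambda>b a. c a b) b a * y ^ b * x ^ a)"
    by force
  then show ?thesis
    unfolding Q_on_def mem_Collect_eq by (rule exI[of _ "\<lambda>b a. c a b"])
qed

lemma swap_cell: "prod.swap ` cell X Y i j = cell Y X j i"
  by (auto simp: cell_def)

lemma U_h_swap:
  assumes "v \<in> U_h k Nx X Ny Y"
  shows "v \<circ> prod.swap \<in> U_h k Ny Y Nx X"
  using assms Q_on_swap[of v k "cell X Y _ _"] by (simp add: U_h_def swap_cell)

lemma continuous_on_U_h:
  assumes "v \<in> U_h k Nx X Ny Y"
  shows "continuous_on (cells Nx X Ny Y) v"
proof -
  have "continuous_on (cell X Y i j) v" if "i \<in> {1..Nx}" "j \<in> {1..Ny}" for i j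
  proof -
    have "v \<in> Q_on k (cell X Y i j)"
      using assms that by (simp add: U_h_def)
    then obtain P Py where "continuous_on UNIV P" "\<And>z. z \<in> cell X Y i j \<Longrightarrow> v z = P z"
      by (rule Q_on_extension) blast
    then show ?thesis
      by (metis continuous_on_cong continuous_on_subset subset_UNIV)
  qed
  then show ?thesis
    unfolding cells_def by (intro continuous_on_open_UN open_UN) (auto simp: open_cell)
qed

text \<open>On each open cell the values are among those of a continuous function on the compact
  closed rectangle, and there are finitely many cells.\<close>

lemma bmeas_U_h:
  assumes "v \<in> U_h k Nx X Ny Y"
  shows "bmeas (cells Nx X Ny Y) v"
proof -
  have "bounded (v ` cell X Y i j)" if "i \<in> {1..Nx}" "j \<in> {1..Ny}" for i j
  proof -
    have "v \<in> Q_on k (cell X Y i j)"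
      using assms that by (simp add: U_h_def)
    then obtain P Py where P: "continuous_on UNIV P" "\<And>z. z \<in> cell X Y i j \<Longrightarrow> v z = P z"
      by (rule Q_on_extension) blast
    have "v ` cell X Y i j \<subseteq> P ` ({X (i - 1)..X i} \<times> {Y (j - 1)..Y j})"
      using P(2) by (force simp: cell_def)
    moreover have "compact (P ` ({X (i - 1)..X i} \<times> {Y (j - 1)..Y j}))"
      using P(1) by (intro compact_continuous_image compact_Times compact_Icc) (rule continuous_on_subset, auto)
    ultimately show ?thesis
      using bounded_subset compact_imp_bounded by blast
  qed
  then have "bounded (v ` cells Nx X Ny Y)"
    unfolding cells_def image_UN by (intro bounded_UN ballI) simp_all
  moreover have "v \<in> borel_measurable (lebesgue_on (cells Nx X Ny Y))"
    using continuous_on_U_h[OF assms] open_cells by (intro continuous_imp_measurable_on_sets_lebesgue) auto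
  ultimately show ?thesis
    by (simp add: bmeas_def)
qed

subsection \<open>Numerical fluxes\<close>

lemma yminus_extension:
  assumes P: "continuous_on UNIV P" "\<And>z. z \<in> {a<..<b} \<times> {c<..<d} \<Longrightarrow> v z = P z"
    and x: "x \<in> {a<..<b}" and cd: "c < d"
  shows "((\<lambda>\<eta>. v (x, \<eta>)) \<longlongrightarrow> P (x, d)) (at_left d)" "yminus v x d = P (x, d)"
proof -
  have "continuous_on UNIV (\<lambda>\<eta>. P (x, \<eta>))"
    by (rule continuous_on_compose2[OF P(1)]) (auto intro!: continuous_intros)
  then have "((\<lambda>\<eta>. P (x, \<eta>)) \<longlongrightarrow> P (x, d)) (at_left d)"
    by (simp add: continuous_on_def) (meson filterlim_mono order_refl at_le top_greatest)
  moreover have "\<forall>\<^sub>F \<eta> in at_left d. P (x, \<eta>) = v (x, \<eta>)"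
    using P(2) x by (intro eventually_at_leftI[OF _ cd]) simp
  ultimately show "((\<lambda>\<eta>. v (x, \<eta>)) \<longlongrightarrow> P (x, d)) (at_left d)"
    by (rule Lim_transform_eventually)
  then show "yminus v x d = P (x, d)"
    unfolding yminus_def by (intro tendsto_Lim) simp_all
qed

lemma yplus_extension:
  assumes P: "continuous_on UNIV P" "\<And>z. z \<in> {a<..<b} \<times> {c<..<d} \<Longrightarrow> v z = P z"
    and x: "x \<in> {a<..<b}" and cd: "c < d"
  shows "((\<lambda>\<eta>. v (x, \<eta>)) \<longlongrightarrow> P (x, c)) (at_right c)" "yplus v x c = P (x, c)"
proof -
  have "continuous_on UNIV (\<lambda>\<eta>. P (x, \<eta>))"
    by (rule continuous_on_compose2[OF P(1)]) (auto intro!: continuous_intros)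
  then have "((\<lambda>\<eta>. P (x, \<eta>)) \<longlongrightarrow> P (x, c)) (at_right c)"
    by (simp add: continuous_on_def) (meson filterlim_mono order_refl at_le top_greatest)
  moreover have "\<forall>\<^sub>F \<eta> in at_right c. P (x, \<eta>) = v (x, \<eta>)"
    using P(2) x by (intro eventually_at_rightI[OF _ cd]) simp
  ultimately show "((\<lambda>\<eta>. v (x, \<eta>)) \<longlongrightarrow> P (x, c)) (at_right c)"
    by (rule Lim_transform_eventually)
  then show "yplus v x c = P (x, c)"
    unfolding yplus_def by (intro tendsto_Lim) simp_all
qed

lemma dy_extension:
  assumes P: "\<And>x y. ((\<lambda>\<eta>. P (x, \<eta>)) has_real_derivative Py (x, y)) (at y)"
    and eq: "\<And>z. z \<in> {a<..<b} \<times> {c<..<d} \<Longrightarrow> v z = P z"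
    and z: "z \<in> {a<..<b} \<times> {c<..<d}"
  shows "dy v z = Py z"
proof -
  obtain x y where xy: "z = (x, y)" "x \<in> {a<..<b}" "y \<in> {c<..<d}"
    using z by auto
  have "((\<lambda>\<eta>. v (x, \<eta>)) has_real_derivative Py (x, y)) (at y)"
    by (rule has_field_derivative_transform_within_open[OF P, where S = "{c<..<d}"])
      (use xy eq in auto)
  then show ?thesis
    by (simp add: dy_def xy DERIV_imp_deriv)
qed

text \<open>The scheme uses Lebesgue integrals over open sets, whereas the fundamental theorem of
  calculus and the exchange of iterated integrals are applied to gauge integrals over closed
  intervals. The continuous extension \<open>g\<close> mediates between the two.\<close>

lemma interval_integral_extension:
  fixes f g :: "real \<Rightarrow> real"
  assumes g: "continuous_on UNIV g" and eq: "\<And>x. x \<in> {a<..<b} \<Longrightarrow> f x = g x"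
  shows "set_integrable lebesgue {a<..<b} f"
    and "(LINT x:{a<..<b}|lebesgue. f x) = integral {a..b} g"
proof -
  have g': "set_integrable lebesgue {a<..<b} g"
    by (rule set_integrable_subset[OF absolutely_integrable_continuous_real[of a b]])
      (use g continuous_on_subset in auto)
  then show "set_integrable lebesgue {a<..<b} f"
    using set_integrable_cong[of lebesgue lebesgue "{a<..<b}" "{a<..<b}" f g] eq by blast
  have "(LINT x:{a<..<b}|lebesgue. f x) = (LINT x:{a<..<b}|lebesgue. g x)"
    using eq by (intro set_lebesgue_integral_cong) auto
  then show "(LINT x:{a<..<b}|lebesgue. f x) = integral {a..b} g"
    using g' by (simp add: set_lebesgue_integral_eq_integral integral_open_interval_real)
qed

lemma cell_integral_extension:
  fixes f g :: field
  assumes g: "continuous_on UNIV g" and eq: "\<And>z. z \<in> {a<..<b} \<times> {c<..<d} \<Longrightarrow> f z = g z"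
  shows "set_integrable lebesgue ({a<..<b} \<times> {c<..<d}) f"
    and "(LINT z:{a<..<b} \<times> {c<..<d}|lebesgue. f z) =
      integral {a..b} (\<lambda>x. integral {c..d} (\<lambda>y. g (x, y)))"
proof -
  have box: "{a<..<b} \<times> {c<..<d} = box (a, c) (b, d)"
    by (simp add: box_prod)
  have cont: "continuous_on (cbox (a, c) (b, d)) g"
    using g continuous_on_subset by blast
  have g': "set_integrable lebesgue (box (a, c) (b, d)) g"
    by (rule set_integrable_subset[OF absolutely_integrable_continuous[OF cont]])
      (auto simp: box_subset_cbox)
  show "set_integrable lebesgue ({a<..<b} \<times> {c<..<d}) f"
    using set_integrable_cong[of lebesgue lebesgue "box (a, c) (b, d)" "box (a, c) (b, d)" f g] g' eq
    unfolding box by blast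
  have "(LINT z:box (a, c) (b, d)|lebesgue. f z) = (LINT z:box (a, c) (b, d)|lebesgue. g z)"
    using eq unfolding box by (intro set_lebesgue_integral_cong) auto
  also have "\<dots> = integral (cbox (a, c) (b, d)) g"
    using g' by (simp add: set_lebesgue_integral_eq_integral integral_open_interval)
  finally show "(LINT z:{a<..<b} \<times> {c<..<d}|lebesgue. f z) =
      integral {a..b} (\<lambda>x. integral {c..d} (\<lambda>y. g (x, y)))"
    using integral_prod_continuous[OF cont] by (simp add: box)
qed

text \<open>The sum of the two integrands is the \<open>y\<close> derivative of the product
  \<open>u v\<close>. Integrating in \<open>y\<close> first leaves the product at both ends of each
  vertical slice, which are the traces from inside the cell: the minus side on the upper edge, the
  plus side on the lower edge.\<close>

lemma cell_integration_by_parts: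
  assumes u: "u \<in> Q_on k ({a<..<b} \<times> {c<..<d})" and v: "v \<in> Q_on k ({a<..<b} \<times> {c<..<d})"
    and cd: "c < d"
  shows "(LINT z:{a<..<b} \<times> {c<..<d}|lebesgue. u z * dy v z)
      + (LINT z:{a<..<b} \<times> {c<..<d}|lebesgue. v z * dy u z)
    = (LINT x:{a<..<b}|lebesgue. yminus u x d * yminus v x d - yplus u x c * yplus v x c)"
proof -
  let ?K = "{a<..<b} \<times> {c<..<d}"
  obtain P Py where P: "continuous_on UNIV P" "continuous_on UNIV Py"
    "\<And>x y. ((\<lambda>\<eta>. P (x, \<eta>)) has_real_derivative Py (x, y)) (at y)"
    "\<And>z. z \<in> ?K \<Longrightarrow> u z = P z"
    using Q_on_extension[OF u] by blast
  obtain Q Qy where Q: "continuous_on UNIV Q" "continuous_on UNIV Qy"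
    "\<And>x y. ((\<lambda>\<eta>. Q (x, \<eta>)) has_real_derivative Qy (x, y)) (at y)"
    "\<And>z. z \<in> ?K \<Longrightarrow> v z = Q z"
    using Q_on_extension[OF v] by blast
  have uv: "u z * dy v z = P z * Qy z" "v z * dy u z = Q z * Py z" if "z \<in> ?K" for z
    using P(4)[OF that] Q(4)[OF that] dy_extension[OF P(3,4) that] dy_extension[OF Q(3,4) that]
    by simp_all
  have cont: "continuous_on UNIV (\<lambda>z. P z * Qy z)" "continuous_on UNIV (\<lambda>z. Q z * Py z)"
    using P(1,2) Q(1,2) by (auto intro: continuous_intros)
  have slice: "continuous_on UNIV (\<lambda>x. R (x, y))" if "continuous_on UNIV R" for R :: field and y
    by (rule continuous_on_compose2[OF that]) (auto intro!: continuous_intros)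
  have "(LINT z:?K|lebesgue. u z * dy v z) + (LINT z:?K|lebesgue. v z * dy u z)
      = (LINT z:?K|lebesgue. u z * dy v z + v z * dy u z)"
    using cell_integral_extension(1)[OF cont(1) uv(1)] cell_integral_extension(1)[OF cont(2) uv(2)]
    by (simp add: set_integral_add)
  also have "\<dots> = integral {a..b} (\<lambda>x. integral {c..d} (\<lambda>y. P (x, y) * Qy (x, y) + Q (x, y) * Py (x, y)))"
    by (rule cell_integral_extension(2)) (use uv cont in \<open>auto intro: continuous_on_add\<close>)
  also have "\<dots> = integral {a..b} (\<lambda>x. P (x, d) * Q (x, d) - P (x, c) * Q (x, c))"
  proof (rule Henstock_Kurzweil_Integration.integral_cong)
    fix x
    have "((\<lambda>y. P (x, y) * Qy (x, y) + Q (x, y) * Py (x, y)) has_integral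
        P (x, d) * Q (x, d) - P (x, c) * Q (x, c)) {c..d}"
    proof (rule fundamental_theorem_of_calculus)
      fix y
      have "((\<lambda>\<eta>. P (x, \<eta>) * Q (x, \<eta>)) has_real_derivative
          P (x, y) * Qy (x, y) + Q (x, y) * Py (x, y)) (at y within {c..d})"
        by (rule has_field_derivative_at_within) (rule DERIV_cong[OF DERIV_mult[OF P(3) Q(3)]], simp)
      then show "((\<lambda>\<eta>. P (x, \<eta>) * Q (x, \<eta>)) has_vector_derivative
          P (x, y) * Qy (x, y) + Q (x, y) * Py (x, y)) (at y within {c..d})"
        by (simp add: has_real_derivative_iff_has_vector_derivative)
    qed (use cd in simp)
    then show "integral {c..d} (\<lambda>y. P (x, y) * Qy (x, y) + Q (x, y) * Py (x, y))
        = P (x, d) * Q (x, d) - P (x, c) * Q (x, c)"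
      by (rule integral_unique)
  qed
  also have "\<dots> = (LINT x:{a<..<b}|lebesgue. yminus u x d * yminus v x d - yplus u x c * yplus v x c)"
    by (rule interval_integral_extension(2)[symmetric])
      (use slice P(1) Q(1) yminus_extension(2)[OF P(1,4) _ cd] yminus_extension(2)[OF Q(1,4) _ cd]
         yplus_extension(2)[OF P(1,4) _ cd] yplus_extension(2)[OF Q(1,4) _ cd]
       in \<open>auto intro!: continuous_intros\<close>)
  finally show ?thesis .
qed

text \<open>Both sides are iterated integrals of the same continuous function, taken in opposite
  orders.\<close>

lemma cell_integral_swap:
  fixes f :: field
  assumes g: "continuous_on UNIV g" and eq: "\<And>z. z \<in> {a<..<b} \<times> {c<..<d} \<Longrightarrow> f z = g z"
  shows "(LINT z:{a<..<b} \<times> {c<..<d}|lebesgue. f z)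
    = (LINT z:{c<..<d} \<times> {a<..<b}|lebesgue. (f \<circ> prod.swap) z)"
proof -
  have "continuous_on UNIV (g \<circ> prod.swap)"
    by (intro continuous_on_compose continuous_on_swap continuous_on_subset[OF g]) auto
  then have "(LINT z:{c<..<d} \<times> {a<..<b}|lebesgue. (f \<circ> prod.swap) z)
      = integral {c..d} (\<lambda>x. integral {a..b} (\<lambda>y. (g \<circ> prod.swap) (x, y)))"
    by (rule cell_integral_extension(2)) (use eq in auto)
  also have "\<dots> = integral {a..b} (\<lambda>x. integral {c..d} (\<lambda>y. g (x, y)))"
    using integral_swap_continuous[of a c b d "\<lambda>x y. g (x, y)"] continuous_on_subset[OF g] by simp
  also have "\<dots> = (LINT z:{a<..<b} \<times> {c<..<d}|lebesgue. f z)"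
    by (rule cell_integral_extension(2)[OF g eq, symmetric])
  finally show ?thesis ..
qed

text \<open>Continuity on the open interval alone would not make traces and fluxes integrable, as
  they could blow up at the ends. A continuous extension to the line does, and this property is
  preserved by sums, differences and products.\<close>

definition cont_ext :: "real set \<Rightarrow> (real \<Rightarrow> real) \<Rightarrow> bool" where
  "cont_ext I f \<longleftrightarrow> (\<exists>g. continuous_on UNIV g \<and> (\<forall>x\<in>I. f x = g x))"

lemma cont_ext_const: "cont_ext I (\<lambda>x. c)"
  unfolding cont_ext_def by (rule exI[of _ "\<lambda>x. c"]) simp

lemma cont_ext_add: "cont_ext I f \<Longrightarrow> cont_ext I g \<Longrightarrow> cont_ext I (\<lambda>x. f x + g x)"
  unfolding cont_ext_def
proof (elim exE conjE)
  fix f' g' assume "continuous_on UNIV f'" "continuous_on UNIV g'" "\<forall>x\<in>I. f x = f' x" "\<forall>x\<in>I. g x = g' x"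
  then show "\<exists>h. continuous_on UNIV h \<and> (\<forall>x\<in>I. f x + g x = h x)"
    by (intro exI[of _ "\<lambda>x. f' x + g' x"]) (simp add: continuous_on_add)
qed

lemma cont_ext_diff: "cont_ext I f \<Longrightarrow> cont_ext I g \<Longrightarrow> cont_ext I (\<lambda>x. f x - g x)"
  unfolding cont_ext_def
proof (elim exE conjE)
  fix f' g' assume "continuous_on UNIV f'" "continuous_on UNIV g'" "\<forall>x\<in>I. f x = f' x" "\<forall>x\<in>I. g x = g' x"
  then show "\<exists>h. continuous_on UNIV h \<and> (\<forall>x\<in>I. f x - g x = h x)"
    by (intro exI[of _ "\<lambda>x. f' x - g' x"]) (simp add: continuous_on_diff)
qed

lemma cont_ext_mult: "cont_ext I f \<Longrightarrow> cont_ext I g \<Longrightarrow> cont_ext I (\<lambda>x. f x * g x)"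
  unfolding cont_ext_def
proof (elim exE conjE)
  fix f' g' assume "continuous_on UNIV f'" "continuous_on UNIV g'" "\<forall>x\<in>I. f x = f' x" "\<forall>x\<in>I. g x = g' x"
  then show "\<exists>h. continuous_on UNIV h \<and> (\<forall>x\<in>I. f x * g x = h x)"
    by (intro exI[of _ "\<lambda>x. f' x * g' x"]) (simp add: continuous_on_mult)
qed

lemma cont_ext_integrable: "cont_ext {a<..<b} f \<Longrightarrow> set_integrable lebesgue {a<..<b} f"
  unfolding cont_ext_def using interval_integral_extension(1) by blast

lemma cont_ext_traces:
  assumes v: "v \<in> Q_on k ({a<..<b} \<times> {c<..<d})" and cd: "c < d"
  shows "cont_ext {a<..<b} (\<lambda>x. yminus v x d)" "cont_ext {a<..<b} (\<lambda>x. yplus v x c)"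
proof -
  obtain P where P: "continuous_on UNIV P" "\<And>z. z \<in> {a<..<b} \<times> {c<..<d} \<Longrightarrow> v z = P z"
    using Q_on_extension[OF v] by metis
  have slice: "continuous_on UNIV (\<lambda>x. P (x, y))" for y
    by (rule continuous_on_compose2[OF P(1)]) (auto intro!: continuous_intros)
  show "cont_ext {a<..<b} (\<lambda>x. yminus v x d)"
    unfolding cont_ext_def by (rule exI[of _ "\<lambda>x. P (x, d)"]) (simp add: slice yminus_extension(2)[OF P _ cd])
  show "cont_ext {a<..<b} (\<lambda>x. yplus v x c)"
    unfolding cont_ext_def by (rule exI[of _ "\<lambda>x. P (x, c)"]) (simp add: slice yplus_extension(2)[OF P _ cd])
qed

text \<open>The parameter \<open>c\<close> may be negative: the fluxes through vertical mesh lines are obtained from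
  this lemma by swapping the coordinates and taking \<open>c = - c0\<close>.\<close>

lemma horizontal_fluxes:
  assumes Y: "\<And>j. j \<in> {1..N} \<Longrightarrow> Y (j - 1) < Y j" and N: "N \<ge> 1"
    and u: "\<And>j. j \<in> {1..N} \<Longrightarrow> u \<in> Q_on k ({a<..<b} \<times> {Y (j - 1)<..<Y j})"
    and v: "\<And>j. j \<in> {1..N} \<Longrightarrow> v \<in> Q_on k ({a<..<b} \<times> {Y (j - 1)<..<Y j})"
  shows "(\<Sum>j\<in>{1..N}.
      - (LINT x:{a<..<b}|lebesgue. H_z_hat_y c Y v u j x * yminus u x (Y j)
           - H_z_hat_y c Y v u (j - 1) x * yplus u x (Y (j - 1)))
      + (LINT z:{a<..<b} \<times> {Y (j - 1)<..<Y j}|lebesgue. v z * dy u z)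
      - (LINT x:{a<..<b}|lebesgue. E_x_hat N Y u j x * yminus v x (Y j)
           - E_x_hat N Y u (j - 1) x * yplus v x (Y (j - 1)))
      + (LINT z:{a<..<b} \<times> {Y (j - 1)<..<Y j}|lebesgue. u z * dy v z))
    = c * (LINT x:{a<..<b}|lebesgue. (yplus u x (Y 0))\<^sup>2)" (is "sum ?F _ = ?R")
proof -
  let ?L = "\<lambda>f. LINT x:{a<..<b}|lebesgue. f x"
  \<comment> \<open>The quantity passed through the mesh line \<open>Y j\<close>. Alternating fluxes
    pair the plus trace of \<open>u\<close> with the minus trace of \<open>v\<close>. It is set to 0
    on the two outer lines, where the flux of \<open>u\<close> vanishes.\<close>
  define A where "A j = (if j = 0 \<or> j = N then 0 else ?L (\<lambda>x. yplus u x (Y j) * yminus v x (Y j)))" for j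
  have minus: "cont_ext {a<..<b} (\<lambda>x. yminus u x (Y j))" "cont_ext {a<..<b} (\<lambda>x. yminus v x (Y j))"
    and plus: "cont_ext {a<..<b} (\<lambda>x. yplus u x (Y (j - 1)))" "cont_ext {a<..<b} (\<lambda>x. yplus v x (Y (j - 1)))"
    if "j \<in> {1..N}" for j
    by (rule cont_ext_traces[OF u[OF that] Y[OF that]] cont_ext_traces[OF v[OF that] Y[OF that]])+
  \<comment> \<open>The plus trace on \<open>Y j\<close> belongs to the cell above, which has index
    \<open>Suc j\<close>; hence the restriction to \<open>j < N\<close>.\<close>
  have plus': "cont_ext {a<..<b} (\<lambda>x. yplus u x (Y j))" "cont_ext {a<..<b} (\<lambda>x. yplus v x (Y j))" if "j < N" for j
  proof -
    have "Suc j \<in> {1..N}"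
      using that by simp
    from plus[OF this] show "cont_ext {a<..<b} (\<lambda>x. yplus u x (Y j))" "cont_ext {a<..<b} (\<lambda>x. yplus v x (Y j))"
      by (simp_all only: diff_Suc_1)
  qed
  have step: "?F j = A (j - 1) - A j + (if j = 1 then ?R else 0)" if j: "j \<in> {1..N}" for j
  proof -
    let ?up = "\<lambda>x. yplus u x (Y (j - 1))" and ?um = "\<lambda>x. yminus u x (Y j)"
      and ?vp = "\<lambda>x. yplus v x (Y (j - 1))" and ?vm = "\<lambda>x. yminus v x (Y j)"
      and ?H = "H_z_hat_y c Y v u" and ?E = "E_x_hat N Y u"
    have H: "cont_ext {a<..<b} (?H j)" "cont_ext {a<..<b} (?H (j - 1))"
    proof -
      have "cont_ext {a<..<b} (?H i)" if "i \<le> N" for i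
        using that minus[of i] plus[of 1] N
        by (cases "i = 0") (simp_all add: H_z_hat_y_def[abs_def] cont_ext_add cont_ext_mult cont_ext_const)
      from this[of j] this[of "j - 1"]
      show "cont_ext {a<..<b} (?H j)" "cont_ext {a<..<b} (?H (j - 1))"
        using j by (auto simp: le_diff_conv)
    qed
    have E: "cont_ext {a<..<b} (?E j)" "cont_ext {a<..<b} (?E (j - 1))"
    proof -
      have "cont_ext {a<..<b} (?E i)" if "i \<le> N" for i
        using that plus'[of i]
        by (cases "i = 0 \<or> i = N") (auto simp: E_x_hat_def[abs_def] cont_ext_const)
      from this[of j] this[of "j - 1"]
      show "cont_ext {a<..<b} (?E j)" "cont_ext {a<..<b} (?E (j - 1))"
        using j by (auto simp: le_diff_conv)
    qed
    have I: "set_integrable lebesgue {a<..<b} (\<lambda>x. ?um x * ?vm x - ?up x * ?vp x)"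
      "set_integrable lebesgue {a<..<b} (\<lambda>x. ?H j x * ?um x - ?H (j - 1) x * ?up x)"
      "set_integrable lebesgue {a<..<b} (\<lambda>x. ?E j x * ?vm x - ?E (j - 1) x * ?vp x)"
      by (intro cont_ext_integrable cont_ext_diff cont_ext_mult minus[OF j] plus[OF j] H E)+
    have ibp: "(LINT z:{a<..<b} \<times> {Y (j - 1)<..<Y j}|lebesgue. u z * dy v z)
        + (LINT z:{a<..<b} \<times> {Y (j - 1)<..<Y j}|lebesgue. v z * dy u z)
        = ?L (\<lambda>x. ?um x * ?vm x - ?up x * ?vp x)"
      by (rule cell_integration_by_parts[OF u[OF j] v[OF j] Y[OF j]])
    have "?F j = ?L (\<lambda>x. ?um x * ?vm x - ?up x * ?vp x)
        - ?L (\<lambda>x. ?H j x * ?um x - ?H (j - 1) x * ?up x) - ?L (\<lambda>x. ?E j x * ?vm x - ?E (j - 1) x * ?vp x)"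
      using ibp by linarith
    also have "\<dots> = ?L (\<lambda>x. ?um x * ?vm x - ?up x * ?vp x
        - (?H j x * ?um x - ?H (j - 1) x * ?up x) - (?E j x * ?vm x - ?E (j - 1) x * ?vp x))"
      by (simp only: set_integral_diff(2)[OF I(1,2)] set_integral_diff(2)[OF set_integral_diff(1)[OF I(1,2)] I(3)])
    \<comment> \<open>The product of the upper inner traces cancels against the flux of
      \<open>v\<close> at \<open>Y j\<close>. For \<open>j > 1\<close> the product of the lower
      inner traces cancels against the flux of \<open>u\<close> at \<open>Y (j - 1)\<close>. For
      \<open>j = 1\<close> that flux is zero and the cancellation comes from the flux of
      \<open>v\<close> instead, whose penalty survives with factor \<open>c\<close>.\<close>
    also have "\<dots> = ?L (\<lambda>x. (if j = 1 then 0 else yplus u x (Y (j - 1)) * yminus v x (Y (j - 1)))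
        - (if j = N then 0 else yplus u x (Y j) * yminus v x (Y j))
        + (if j = 1 then c * (yplus u x (Y 0))\<^sup>2 else 0))"
    proof (rule set_lebesgue_integral_cong, goal_cases)
      case 2
      have "j \<noteq> 0" "j - 1 = 0 \<longleftrightarrow> j = 1" "j - 1 \<noteq> N" "1 - 1 = (0::nat)"
        using j by auto
      then show ?case
        by (cases "j = 1"; cases "j = N")
          (simp_all add: H_z_hat_y_def E_x_hat_def power2_eq_square ring_distribs)
    qed simp
    also have "\<dots> = A (j - 1) - A j + (if j = 1 then ?R else 0)"
    proof -
      have 1: "cont_ext {a<..<b} (\<lambda>x. if j = 1 then 0 else yplus u x (Y (j - 1)) * yminus v x (Y (j - 1)))"
      proof (cases "j = 1")
        case False
        then have "j - 1 \<in> {1..N}"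
          using j by auto
        then show ?thesis
          using cont_ext_mult[OF plus(1)[OF j] minus(2)] False by simp
      qed (simp add: cont_ext_const)
      have 2: "cont_ext {a<..<b} (\<lambda>x. if j = N then 0 else yplus u x (Y j) * yminus v x (Y j))"
        using j minus[of j] plus'[of j] by (cases "j = N") (simp_all add: cont_ext_const cont_ext_mult)
      have 3: "cont_ext {a<..<b} (\<lambda>x. if j = 1 then c * (yplus u x (Y 0))\<^sup>2 else 0)"
        using plus[of 1] N by (cases "j = 1") (simp_all add: power2_eq_square cont_ext_const cont_ext_mult)
      have "?L (\<lambda>x. (if j = 1 then 0 else yplus u x (Y (j - 1)) * yminus v x (Y (j - 1)))
          - (if j = N then 0 else yplus u x (Y j) * yminus v x (Y j))
          + (if j = 1 then c * (yplus u x (Y 0))\<^sup>2 else 0))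
        = ?L (\<lambda>x. if j = 1 then 0 else yplus u x (Y (j - 1)) * yminus v x (Y (j - 1)))
          - ?L (\<lambda>x. if j = N then 0 else yplus u x (Y j) * yminus v x (Y j))
          + ?L (\<lambda>x. if j = 1 then c * (yplus u x (Y 0))\<^sup>2 else 0)"
        by (simp only: set_integral_add(2)[OF cont_ext_integrable[OF cont_ext_diff[OF 1 2]] cont_ext_integrable[OF 3]]
            set_integral_diff(2)[OF cont_ext_integrable[OF 1] cont_ext_integrable[OF 2]])
      also have "\<dots> = A (j - 1) - A j + (if j = 1 then ?R else 0)"
        using j by (auto simp: A_def)
      finally show ?thesis .
    qed
    finally show ?thesis .
  qed
  have "sum ?F {1..N} = (\<Sum>j\<in>{1..N}. A (j - 1) - A j + (if j = 1 then ?R else 0))"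
    by (rule sum.cong[OF refl step])
  also have "\<dots> = (\<Sum>j\<in>{1..N}. A (j - 1) - A j) + ?R"
    using N by (simp add: sum.distrib)
  also have "(\<Sum>j\<in>{1..N}. A (j - 1) - A j) = A 0 - A N"
    using sum_telescope''[of 0 N "\<lambda>j. - A j"] by (simp add: atLeastSucAtMost_greaterThanAtMost)
  finally show ?thesis
    by (simp add: A_def)
qed

lemma U_h_cell:
  assumes "v \<in> U_h k Nx X Ny Y" "i \<in> {1..Nx}" "j \<in> {1..Ny}"
  shows "v \<in> Q_on k ({X (i - 1)<..<X i} \<times> {Y (j - 1)<..<Y j})"
  using assms by (simp add: U_h_def cell_def)

lemma yplus_U_h_cont_ext:
  assumes "v \<in> U_h k Nx X Ny Y" "grid p q Ny Y" "p < q" "i \<in> {1..Nx}"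
  shows "cont_ext {X (i - 1)<..<X i} (\<lambda>x. yplus v x (Y 0))"
proof -
  have 1: "1 \<in> {1..Ny}"
    using grid_pos[OF assms(2,3)] by simp
  show ?thesis
    using cont_ext_traces(2)[OF U_h_cell[OF assms(1,4) 1] grid_less[OF assms(2) 1]] by simp
qed

text \<open>The sum over \<open>j\<close> telescopes within each column of cells. What is left are
  penalty integrals over the mesh intervals in \<open>x\<close>, which together make up the integral
  over the bottom side.\<close>

lemma horizontal_flux_sum:
  assumes X: "grid r s Nx X" and Y: "grid p q Ny Y" and pq: "p < q"
    and u: "u \<in> U_h k Nx X Ny Y" and v: "v \<in> U_h k Nx X Ny Y"
  shows "(\<Sum>i\<in>{1..Nx}. \<Sum>j\<in>{1..Ny}.
      - (LINT x:{X (i - 1)<..<X i}|lebesgue. H_z_hat_y c Y v u j x * yminus u x (Y j)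
           - H_z_hat_y c Y v u (j - 1) x * yplus u x (Y (j - 1)))
      + (LINT z:cell X Y i j|lebesgue. v z * dy u z)
      - (LINT x:{X (i - 1)<..<X i}|lebesgue. E_x_hat Ny Y u j x * yminus v x (Y j)
           - E_x_hat Ny Y u (j - 1) x * yplus v x (Y (j - 1)))
      + (LINT z:cell X Y i j|lebesgue. u z * dy v z))
    = c * (LINT x:{r<..<s}|lebesgue. (yplus u x p)\<^sup>2)" (is "(\<Sum>i\<in>_. ?F i) = _")
proof -
  have "?F i = c * (LINT x:{X (i - 1)<..<X i}|lebesgue. (yplus u x (Y 0))\<^sup>2)" if i: "i \<in> {1..Nx}" for i
    unfolding cell_def
    by (rule horizontal_fluxes[where Y = Y and N = Ny and k = k and u = u and v = v])
      (rule grid_less[OF Y] grid_pos[OF Y pq] U_h_cell[OF u i] U_h_cell[OF v i], assumption?)+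
  then have "(\<Sum>i\<in>{1..Nx}. ?F i) = (\<Sum>i\<in>{1..Nx}. c * (LINT x:{X (i - 1)<..<X i}|lebesgue. (yplus u x (Y 0))\<^sup>2))"
    by (intro sum.cong) simp_all
  also have "\<dots> = c * (LINT x:{r<..<s}|lebesgue. (yplus u x (Y 0))\<^sup>2)"
    unfolding sum_distrib_left[symmetric] power2_eq_square
    by (subst integral_lines[OF X])
      (intro cont_ext_integrable cont_ext_mult yplus_U_h_cont_ext[OF u Y pq], assumption+, simp)
  finally show ?thesis
    using Y by (simp add: grid_def)
qed

section \<open>Vertical fluxes by exchange of the coordinates\<close>

lemma cell_integral_dx:
  assumes u: "u \<in> Q_on k ({a<..<b} \<times> {c<..<d})" and v: "v \<in> Q_on k ({a<..<b} \<times> {c<..<d})"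
  shows "(LINT z:{a<..<b} \<times> {c<..<d}|lebesgue. v z * dx u z)
    = (LINT z:{c<..<d} \<times> {a<..<b}|lebesgue. (v \<circ> prod.swap) z * dy (u \<circ> prod.swap) z)"
proof -
  let ?K = "{c<..<d} \<times> {a<..<b}"
  have us: "u \<circ> prod.swap \<in> Q_on k ?K" and vs: "v \<circ> prod.swap \<in> Q_on k ?K"
    using Q_on_swap[OF u] Q_on_swap[OF v] by (simp_all add: product_swap)
  obtain P Py where P: "continuous_on UNIV P" "continuous_on UNIV Py"
    "\<And>x y. ((\<lambda>\<eta>. P (x, \<eta>)) has_real_derivative Py (x, y)) (at y)"
    "\<And>z. z \<in> ?K \<Longrightarrow> (u \<circ> prod.swap) z = P z"
    using Q_on_extension[OF us] by blast
  obtain Q Qy where Q: "continuous_on UNIV Q" "continuous_on UNIV Qy"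
    "\<And>x y. ((\<lambda>\<eta>. Q (x, \<eta>)) has_real_derivative Qy (x, y)) (at y)"
    "\<And>z. z \<in> ?K \<Longrightarrow> (v \<circ> prod.swap) z = Q z"
    using Q_on_extension[OF vs] by blast
  have "(LINT z:?K|lebesgue. (v \<circ> prod.swap) z * dy (u \<circ> prod.swap) z)
      = (LINT z:{a<..<b} \<times> {c<..<d}|lebesgue. ((\<lambda>z. (v \<circ> prod.swap) z * dy (u \<circ> prod.swap) z) \<circ> prod.swap) z)"
  proof (rule cell_integral_swap)
    show "continuous_on UNIV (\<lambda>z. Q z * Py z)"
      by (rule continuous_on_mult[OF Q(1) P(2)])
    show "(v \<circ> prod.swap) z * dy (u \<circ> prod.swap) z = Q z * Py z" if "z \<in> ?K" for z
      by (simp only: Q(4)[OF that] dy_extension[OF P(3,4) that])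
  qed
  also have "(\<lambda>z. (v \<circ> prod.swap) z * dy (u \<circ> prod.swap) z) \<circ> prod.swap = (\<lambda>z. v z * dx u z)"
    by (auto simp: fun_eq_iff dx_def dy_def)
  finally show ?thesis ..
qed

lemma xplus_eq_yplus_swap: "xplus v x y = yplus (v \<circ> prod.swap) y x"
  by (simp add: xplus_def yplus_def)

lemma xminus_eq_yminus_swap: "xminus v x y = yminus (v \<circ> prod.swap) y x"
  by (simp add: xminus_def yminus_def)

lemma H_z_hat_x_eq_swap:
  "H_z_hat_x c X v u i y = H_z_hat_y (- c) X (v \<circ> prod.swap) (u \<circ> prod.swap) i y"
  by (simp add: H_z_hat_x_def H_z_hat_y_def xplus_eq_yplus_swap xminus_eq_yminus_swap)

lemma E_y_hat_eq_swap: "E_y_hat N X u i y = E_x_hat N X (u \<circ> prod.swap) i y"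
  by (simp add: E_y_hat_def E_x_hat_def xplus_eq_yplus_swap)

text \<open>This is the horizontal case for the mesh with \<open>X\<close> and \<open>Y\<close>
  interchanged and penalty \<open>- c\<close>. The order of summation has to be interchanged too,
  since now the sums over \<open>i\<close> telescope.\<close>

lemma vertical_flux_sum:
  assumes X: "grid r s Nx X" and Y: "grid p q Ny Y" and rs: "r < s"
    and u: "u \<in> U_h k Nx X Ny Y" and v: "v \<in> U_h k Nx X Ny Y"
  shows "(\<Sum>i\<in>{1..Nx}. \<Sum>j\<in>{1..Ny}.
      - (LINT y:{Y (j - 1)<..<Y j}|lebesgue. H_z_hat_x c X v u i y * xminus u (X i) y
           - H_z_hat_x c X v u (i - 1) y * xplus u (X (i - 1)) y)
      + (LINT z:cell X Y i j|lebesgue. v z * dx u z)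
      - (LINT y:{Y (j - 1)<..<Y j}|lebesgue. E_y_hat Nx X u i y * xminus v (X i) y
           - E_y_hat Nx X u (i - 1) y * xplus v (X (i - 1)) y)
      + (LINT z:cell X Y i j|lebesgue. u z * dx v z))
    = - c * (LINT y:{p<..<q}|lebesgue. (xplus u r y)\<^sup>2)"
proof -
  have 1: "(LINT z:cell X Y i j|lebesgue. f z * dx g z)
      = (LINT z:cell Y X j i|lebesgue. (f \<circ> prod.swap) z * dy (g \<circ> prod.swap) z)"
    if "i \<in> {1..Nx}" "j \<in> {1..Ny}" "f \<in> U_h k Nx X Ny Y" "g \<in> U_h k Nx X Ny Y" for i j f g
    unfolding cell_def by (rule cell_integral_dx[OF U_h_cell[OF that(4,1,2)] U_h_cell[OF that(3,1,2)]])
  show ?thesis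
    unfolding H_z_hat_x_eq_swap E_y_hat_eq_swap xplus_eq_yplus_swap xminus_eq_yminus_swap
    by (subst sum.swap, subst horizontal_flux_sum[OF Y X rs U_h_swap[OF u] U_h_swap[OF v], symmetric])
      (intro sum.cong refl, simp add: 1 u v)
qed

section \<open>Dependence of fields and boundary traces on time\<close>

lemma bmeas_lines:
  assumes "\<And>i. i \<in> {1..N} \<Longrightarrow> cont_ext {X (i - 1)<..<X i} f"
  shows "bmeas (lines N X) f"
proof -
  have "continuous_on {X (i - 1)<..<X i} f \<and> bounded (f ` {X (i - 1)<..<X i})" if i: "i \<in> {1..N}" for i
  proof -
    obtain g where g: "continuous_on UNIV g" "\<forall>x\<in>{X (i - 1)<..<X i}. f x = g x"
      using assms[OF i] unfolding cont_ext_def by metis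
    have "f ` {X (i - 1)<..<X i} = g ` {X (i - 1)<..<X i}"
      using g(2) by (intro image_cong) auto
    moreover have "bounded (g ` {X (i - 1)..X i})"
      using continuous_on_subset[OF g(1)] by (intro compact_imp_bounded compact_continuous_image) auto
    ultimately have "bounded (f ` {X (i - 1)<..<X i})"
      by (metis bounded_subset greaterThanLessThan_subseteq_atLeastAtMost_iff image_mono order_refl)
    moreover have "continuous_on {X (i - 1)<..<X i} f"
      using continuous_on_cong[OF refl, of "{X (i - 1)<..<X i}" f g] g continuous_on_subset[OF g(1)] by simp
    ultimately show ?thesis by simp
  qed
  then have "bounded (f ` lines N X)" "continuous_on (lines N X) f"
    unfolding lines_def image_UN by (intro bounded_UN continuous_on_open_UN; simp)+
  then show ?thesis
    unfolding bmeas_def using open_lines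
    by (intro conjI continuous_imp_measurable_on_sets_lebesgue sets_completionI_sets) (simp_all add: borel_open)
qed

text \<open>A trace is the limit of values inside the bottom row of cells. Hence the distance of two
  traces never exceeds the sup distance of the functions on the cells.\<close>

lemma yplus_uniform_limit:
  assumes X: "grid r s Nx X" and Y: "grid p q Ny Y" and pq: "p < q"
    and v: "v \<in> U_h k Nx X Ny Y" and u: "\<forall>\<^sub>F t in F. u t \<in> U_h k Nx X Ny Y"
    and lim: "uniform_limit (cells Nx X Ny Y) u v F"
  shows "uniform_limit (lines Nx X) (\<lambda>t x. yplus (u t) x p) (\<lambda>x. yplus v x p) F"
proof (rule uniform_limitI)
  have Y0: "Y 0 = p" and 1: "1 \<in> {1..Ny}"
    using Y grid_pos[OF Y pq] by (auto simp: grid_def)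
  have conv: "((\<lambda>\<eta>. w (x, \<eta>)) \<longlongrightarrow> yplus w x p) (at_right p)"
    if w: "w \<in> U_h k Nx X Ny Y" and x: "x \<in> {X (i - 1)<..<X i}" and i: "i \<in> {1..Nx}" for w x i
  proof -
    obtain P where P: "continuous_on UNIV P" "\<And>z. z \<in> {X (i - 1)<..<X i} \<times> {Y (1 - 1)<..<Y 1} \<Longrightarrow> w z = P z"
      using Q_on_extension[OF U_h_cell[OF w i 1]] by metis
    show ?thesis
      using yplus_extension[OF P x grid_less[OF Y 1]] Y0 by simp
  qed
  fix e :: real assume e: "e > 0"
  \<comment> \<open>Passing to the limit in space turns strict inequalities into weak ones;
    \<open>e / 2\<close> leaves room for the strict bound.\<close>
  have "\<forall>\<^sub>F t in F. \<forall>z\<in>cells Nx X Ny Y. dist (u t z) (v z) < e / 2"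
    using uniform_limitD[OF lim, of "e / 2"] e by simp
  with u show "\<forall>\<^sub>F t in F. \<forall>x\<in>lines Nx X. dist (yplus (u t) x p) (yplus v x p) < e"
  proof eventually_elim
    case (elim t)
    show ?case
    proof
      fix x assume "x \<in> lines Nx X"
      then obtain i where i: "i \<in> {1..Nx}" "x \<in> {X (i - 1)<..<X i}"
        by (auto simp: lines_def)
      have "\<forall>\<^sub>F \<eta> in at_right p. dist (u t (x, \<eta>)) (v (x, \<eta>)) \<le> e / 2"
      proof (rule eventually_at_rightI)
        show "p < Y 1"
          using grid_less[OF Y 1] Y0 by simp
        fix \<eta> assume "\<eta> \<in> {p<..<Y 1}"
        then have "(x, \<eta>) \<in> cells Nx X Ny Y"
          using i 1 Y0 unfolding cells_eq_Times lines_def by force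
        then show "dist (u t (x, \<eta>)) (v (x, \<eta>)) \<le> e / 2"
          using elim(2) by force
      qed
      then have "dist (yplus (u t) x p) (yplus v x p) \<le> e / 2"
        by (rule tendsto_upperbound[OF tendsto_dist[OF conv[OF elim(1) i(2,1)] conv[OF v i(2,1)]]]) simp
      then show "dist (yplus (u t) x p) (yplus v x p) < e"
        using e by simp
    qed
  qed
qed

lemma C_time_0_D:
  assumes "u \<in> C_time 0 T (cells Nx X Ny Y) (U_h k Nx X Ny Y)"
  shows "\<forall>t\<in>{0..T}. u t \<in> U_h k Nx X Ny Y" "ucont T (cells Nx X Ny Y) u"
  using assms bmeas_U_h by (auto simp: ucont_def)

text \<open>The uniform limit of the difference quotients is in particular a pointwise derivative,
  and derivatives within \<open>{0..T}\<close> are unique because \<open>0 < T\<close>. So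
  \<open>dt\<close> agrees on the cells with the derivative whose existence \<open>C_time\<close>
  asserts, and inherits its regularity there.\<close>

lemma C_time_1_D:
  assumes u: "u \<in> C_time 1 T (cells Nx X Ny Y) (U_h k Nx X Ny Y)" and T: "0 < T"
  shows "\<forall>t\<in>{0..T}. u t \<in> U_h k Nx X Ny Y" "udiff T (cells Nx X Ny Y) u (dt T u)"
proof -
  let ?S = "cells Nx X Ny Y" and ?U = "U_h k Nx X Ny Y"
  obtain u' where u': "u' \<in> C_time 0 T ?S ?U"
    and lim: "\<And>t. t \<in> {0..T} \<Longrightarrow>
      uniform_limit ?S (\<lambda>\<tau> z. (u \<tau> z - u t z) / (\<tau> - t)) (u' t) (at t within {0..T})"
    and U: "\<forall>t\<in>{0..T}. u t \<in> ?U"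
    using u unfolding One_nat_def C_time.simps(2) mem_Collect_eq by (elim conjE bexE) simp
  have eq: "dt T u t z = u' t z" if t: "t \<in> {0..T}" and z: "z \<in> ?S" for t z
  proof -
    have "((\<lambda>\<tau>. (u \<tau> z - u t z) / (\<tau> - t)) \<longlongrightarrow> u' t z) (at t within {0..T})"
      using tendsto_uniform_limitI[OF lim[OF t] z] .
    then have "((\<lambda>\<tau>. u \<tau> z) has_vector_derivative u' t z) (at t within {0..T})"
      unfolding has_real_derivative_iff_has_vector_derivative[symmetric] has_field_derivative_iff .
    then show ?thesis
      unfolding dt_def using vector_derivative_within_cbox[OF T] t by simp
  qed
  have "uniform_limit ?S (\<lambda>\<tau> z. (u \<tau> z - u t z) / (\<tau> - t)) (dt T u t) (at t within {0..T})"
    if t: "t \<in> {0..T}" for t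
    using lim[OF t] by (rule uniform_limit_cong'[THEN iffD1, rotated 2]) (simp_all add: eq[OF t])
  moreover have "bmeas ?S (dt T u t)" if t: "t \<in> {0..T}" for t
  proof (rule bmeas_cong)
    show "bmeas ?S (u' t)"
      by (rule bmeas_U_h[OF bspec[OF C_time_0_D(1)[OF u'] t]])
  qed (simp add: eq[OF t])
  ultimately show "udiff T ?S u (dt T u)"
    unfolding udiff_def using bmeas_U_h[OF bspec[OF U]] by simp
  show "\<forall>t\<in>{0..T}. u t \<in> ?U"
    by (rule U)
qed

lemma yplus_ucont:
  assumes X: "grid r s Nx X" and Y: "grid p q Ny Y" and pq: "p < q"
    and U: "\<forall>t\<in>{0..T}. u t \<in> U_h k Nx X Ny Y" and u: "ucont T (cells Nx X Ny Y) u"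
  shows "ucont T (lines Nx X) (\<lambda>t x. yplus (u t) x p)"
  unfolding ucont_def
proof (intro ballI conjI)
  fix t assume t: "t \<in> {0..T}"
  have ut: "u t \<in> U_h k Nx X Ny Y"
    using U t by blast
  show "bmeas (lines Nx X) (\<lambda>x. yplus (u t) x p)"
    using yplus_U_h_cont_ext[OF ut Y pq] Y by (intro bmeas_lines) (simp add: grid_def)
  show "uniform_limit (lines Nx X) (\<lambda>\<tau> x. yplus (u \<tau>) x p) (\<lambda>x. yplus (u t) x p) (at t within {0..T})"
  proof (rule yplus_uniform_limit[OF X Y pq ut])
    show "\<forall>\<^sub>F \<tau> in at t within {0..T}. u \<tau> \<in> U_h k Nx X Ny Y"
      using U by (simp add: eventually_at_filter)
    show "uniform_limit (cells Nx X Ny Y) u (u t) (at t within {0..T})"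
      using u t unfolding ucont_def by blast
  qed
qed

lemma yplus_integral_continuous:
  assumes X: "grid r s Nx X" and Y: "grid p q Ny Y" and pq: "p < q"
    and U: "\<forall>t\<in>{0..T}. u t \<in> U_h k Nx X Ny Y" and u: "ucont T (cells Nx X Ny Y) u"
  shows "continuous_on {0..T} (\<lambda>t. LINT x:{r<..<s}|lebesgue. (yplus (u t) x p)\<^sup>2)"
proof -
  have "lines Nx X \<in> lmeasurable"
    using bounded_subset[OF _ lines_subset[OF X]] open_lines
    by (intro lmeasurable_open) auto
  then have "set_integrable lebesgue (lines Nx X) (\<lambda>x. 1::real)" "lines Nx X \<in> sets lebesgue"
    by (simp_all add: lmeasurable_iff_integrable set_integrable_def fmeasurableD)
  then have "continuous_on {0..T} (\<lambda>t. LINT x:lines Nx X|lebesgue. yplus (u t) x p * yplus (u t) x p * 1)"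
    by (rule ucont_weighted_integral_continuous[OF ucont_mult[OF yplus_ucont[OF X Y pq U u] yplus_ucont[OF X Y pq U u]]])
  then show ?thesis
    using set_lebesgue_integral_null_diff(1)[OF lines_subset[OF X] negligible_lines[OF X]]
    by (simp add: power2_eq_square)
qed

lemma ucont_swap:
  assumes u: "ucont T (cells Nx X Ny Y) u" and U: "\<forall>t\<in>{0..T}. u t \<in> U_h k Nx X Ny Y"
  shows "ucont T (cells Ny Y Nx X) (\<lambda>t. u t \<circ> prod.swap)"
  unfolding ucont_def
proof (intro ballI conjI)
  fix t assume t: "t \<in> {0..T}"
  show "bmeas (cells Ny Y Nx X) (u t \<circ> prod.swap)"
    using U t by (intro bmeas_U_h U_h_swap) blast
  have "uniform_limit (cells Nx X Ny Y) u (u t) (at t within {0..T})"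
    using u t unfolding ucont_def by blast
  then show "uniform_limit (cells Ny Y Nx X) (\<lambda>t. u t \<circ> prod.swap) (u t \<circ> prod.swap) (at t within {0..T})"
    unfolding comp_def by (rule uniform_limit_compose') (auto simp: cells_eq_Times)
qed

lemma xplus_integral_continuous:
  assumes X: "grid r s Nx X" and Y: "grid p q Ny Y" and rs: "r < s"
    and U: "\<forall>t\<in>{0..T}. u t \<in> U_h k Nx X Ny Y" and u: "ucont T (cells Nx X Ny Y) u"
  shows "continuous_on {0..T} (\<lambda>t. LINT y:{p<..<q}|lebesgue. (xplus (u t) r y)\<^sup>2)"
  unfolding xplus_eq_yplus_swap
  using U U_h_swap by (intro yplus_integral_continuous[OF Y X rs _ ucont_swap[OF u U]]) blast

subsection \<open>Energy balance\<close>

text \<open>The right side of the hypothesis is smallest for \<open>l = b / a\<close>, where it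
  equals \<open>a * b\<close>. As \<open>a\<close> or \<open>b\<close> may be 0, both are enlarged
  by \<open>e > 0\<close> before this choice of \<open>l\<close>, and \<open>e\<close> then tends to
  0.\<close>

lemma le_mult_of_le_weighted:
  fixes a b c :: real
  assumes "\<And>l. l > 0 \<Longrightarrow> c \<le> l / 2 * a\<^sup>2 + b\<^sup>2 / (2 * l)" "a \<ge> 0" "b \<ge> 0"
  shows "c \<le> a * b"
proof -
  have alg: "v / u / 2 * u\<^sup>2 = u * v / 2" "v\<^sup>2 / (2 * (v / u)) = u * v / 2"
    if "u > 0" "v > 0" for u v :: real
    using that by (simp_all add: power2_eq_square)
  have le: "c \<le> (a + e) * (b + e)" if e: "e > 0" for e
  proof -
    define l where "l = (b + e) / (a + e)"
    have p: "a + e > 0" "b + e > 0" "l > 0"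
      using assms(2,3) e by (simp_all add: l_def)
    have sq: "a\<^sup>2 \<le> (a + e)\<^sup>2" "b\<^sup>2 \<le> (b + e)\<^sup>2"
      using assms(2,3) e by (simp_all add: power_mono)
    have "c \<le> l / 2 * a\<^sup>2 + b\<^sup>2 / (2 * l)"
      by (rule assms(1)[OF p(3)])
    also have "\<dots> \<le> l / 2 * (a + e)\<^sup>2 + (b + e)\<^sup>2 / (2 * l)"
      using sq p(3) by (intro add_mono mult_left_mono divide_right_mono) simp_all
    also have "l / 2 * (a + e)\<^sup>2 = (a + e) * (b + e) / 2"
      unfolding l_def by (rule alg(1)[OF p(1,2)])
    also have "(b + e)\<^sup>2 / (2 * l) = (a + e) * (b + e) / 2"
      unfolding l_def by (rule alg(2)[OF p(1,2)])
    finally show ?thesis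
      by simp
  qed
  have "((\<lambda>e. (a + e) * (b + e)) \<longlongrightarrow> (a + 0) * (b + 0)) (at_right 0)"
    by (intro tendsto_intros)
  moreover have "\<forall>\<^sub>F e in at_right 0. c \<le> (a + e) * (b + e)"
    by (rule eventually_at_rightI[of 0 1]) (simp_all add: le)
  ultimately have "c \<le> (a + 0) * (b + 0)"
    by (rule tendsto_lowerbound) simp
  then show ?thesis
    by simp
qed

text \<open>The hypothesis \<open>le\<close> is Young's inequality at each point with a parameter
  \<open>l\<close> common to all points; it is integrated first, and \<open>l\<close> is optimised
  afterwards. In this form \<open>h\<close> may be a scalar product of vector fields, while
  \<open>f\<close> and \<open>g\<close> are squared lengths carrying mutually inverse
  weights.\<close>

lemma set_integral_Cauchy_Schwarz:
  fixes f g h :: "'a \<Rightarrow> real"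
  assumes "set_integrable M S f" "set_integrable M S g" "set_integrable M S h"
    and fg: "\<And>z. z \<in> S \<Longrightarrow> f z \<ge> 0" "\<And>z. z \<in> S \<Longrightarrow> g z \<ge> 0"
    and le: "\<And>z l. z \<in> S \<Longrightarrow> l > 0 \<Longrightarrow> h z \<le> l / 2 * f z + g z / (2 * l)"
  shows "(LINT z:S|M. h z) \<le> sqrt (LINT z:S|M. f z) * sqrt (LINT z:S|M. g z)"
proof (rule le_mult_of_le_weighted)
  have nn: "(LINT z:S|M. f z) \<ge> 0" "(LINT z:S|M. g z) \<ge> 0"
    unfolding set_lebesgue_integral_def
    by (rule Bochner_Integration.integral_nonneg, simp add: fg split: split_indicator)+
  then show "sqrt (LINT z:S|M. f z) \<ge> 0" "sqrt (LINT z:S|M. g z) \<ge> 0"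
    by simp_all
  fix l :: real assume l: "l > 0"
  have "(LINT z:S|M. h z) \<le> (LINT z:S|M. l / 2 * f z + g z / (2 * l))"
  proof (rule set_integral_mono[OF assms(3)])
    show "set_integrable M S (\<lambda>z. l / 2 * f z + g z / (2 * l))"
      using assms(1,2) by (intro set_integral_add set_integrable_mult_right set_integrable_divide)
    show "h z \<le> l / 2 * f z + g z / (2 * l)" if "z \<in> S" for z
      by (rule le[OF that l])
  qed
  also have "\<dots> = l / 2 * (LINT z:S|M. f z) + (LINT z:S|M. g z) / (2 * l)"
    using assms(1,2) by (simp add: set_integral_add)
  finally show "(LINT z:S|M. h z) \<le> l / 2 * (sqrt (LINT z:S|M. f z))\<^sup>2 + (sqrt (LINT z:S|M. g z))\<^sup>2 / (2 * l)"
    using nn by simp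
qed

text \<open>If \<open>M\<close> is the maximum of \<open>f\<close>, integrating up to the maximal point gives
  \<open>M \<le> f 0 + 2 sqrt M A\<close> with \<open>A\<close> the integral of \<open>N\<close>; the square root is absorbed by Young's
  inequality.\<close>

lemma energy_growth_bound:
  fixes f P N :: "real \<Rightarrow> real"
  assumes f: "\<And>t. t \<in> {0..T} \<Longrightarrow> (f has_real_derivative 2 * P t) (at t within {0..T})"
    and N: "continuous_on {0..T} N" "\<And>t. t \<in> {0..T} \<Longrightarrow> 0 \<le> N t"
    and P: "\<And>t. t \<in> {0..T} \<Longrightarrow> P t \<le> N t * sqrt (f t)"
    and f0: "\<And>t. t \<in> {0..T} \<Longrightarrow> 0 \<le> f t"
    and t: "t \<in> {0..T}"
  shows "f t \<le> 2 * f 0 + 4 * (integral {0..t} N)\<^sup>2"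
proof -
  have sub: "{0..\<tau>} \<subseteq> {0..T}" if "\<tau> \<in> {0..t}" for \<tau>
    using t that by auto
  have "continuous_on {0..T} f"
    unfolding continuous_on_eq_continuous_within using DERIV_continuous[OF f] by blast
  then have "continuous_on {0..t} f"
    by (rule continuous_on_subset) (use t in auto)
  moreover have "compact {0..t}" "{0..t} \<noteq> {}"
    using t by auto
  ultimately have "\<exists>m\<in>{0..t}. \<forall>\<tau>\<in>{0..t}. f \<tau> \<le> f m"
    by (intro continuous_attains_sup)
  then obtain m where m: "m \<in> {0..t}" and max: "\<And>\<tau>. \<tau> \<in> {0..t} \<Longrightarrow> f \<tau> \<le> f m"
    by (elim bexE) simp
  define A where "A = integral {0..t} N"
  have Nint: "N integrable_on {0..\<tau>}" if "\<tau> \<in> {0..t}" for \<tau>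
    using continuous_on_subset[OF N(1) sub[OF that]] by (rule integrable_continuous_real)
  have "((\<lambda>\<tau>. 2 * P \<tau>) has_integral f m - f 0) {0..m}"
  proof (rule fundamental_theorem_of_calculus)
    fix \<tau> assume "\<tau> \<in> {0..m}"
    then have "(f has_real_derivative 2 * P \<tau>) (at \<tau> within {0..T})"
      using m t by (intro f) auto
    then show "(f has_vector_derivative 2 * P \<tau>) (at \<tau> within {0..m})"
      unfolding has_real_derivative_iff_has_vector_derivative
      by (rule has_vector_derivative_within_subset[OF _ sub[OF m]])
  qed (use m in simp)
  moreover have "((\<lambda>\<tau>. 2 * sqrt (f m) * N \<tau>) has_integral 2 * sqrt (f m) * integral {0..m} N) {0..m}"
    using Nint[OF m] by (intro has_integral_mult_right) (simp add: has_integral_integral)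
  ultimately have "f m - f 0 \<le> 2 * sqrt (f m) * integral {0..m} N"
  proof (rule has_integral_le)
    fix \<tau> assume \<tau>: "\<tau> \<in> {0..m}"
    then have \<tau>T: "\<tau> \<in> {0..T}" and \<tau>t: "\<tau> \<in> {0..t}"
      using m t by auto
    have "N \<tau> * sqrt (f \<tau>) \<le> N \<tau> * sqrt (f m)"
      using max[OF \<tau>t] N(2)[OF \<tau>T] by (intro mult_left_mono) auto
    then show "2 * P \<tau> \<le> 2 * sqrt (f m) * N \<tau>"
      using P[OF \<tau>T] by (simp add: mult.commute)
  qed
  also have "\<dots> \<le> 2 * sqrt (f m) * A"
  proof -
    have "integral {0..m} N \<le> A"
      unfolding A_def using m t N(2) Nint[OF m] Nint[of t] by (intro integral_subset_le) auto
    moreover have "0 \<le> f m"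
      using m t by (intro f0) auto
    ultimately show ?thesis
      by (intro mult_left_mono) auto
  qed
  finally have "f m \<le> f 0 + 2 * sqrt (f m) * A"
    by simp
  \<comment> \<open>This square is chosen so that \<open>2 * sqrt (f m) * A\<close> is at most
    \<open>f m / 2 + 2 * A\<^sup>2\<close>. Absorbing half of \<open>f m\<close> on the left doubles
    the rest, which gives the constants 2 and 4.\<close>
  moreover have "0 \<le> (sqrt (f m) - 2 * A)\<^sup>2"
    by simp
  then have "4 * (sqrt (f m) * A) \<le> (sqrt (f m))\<^sup>2 + 4 * A\<^sup>2"
    by (simp add: power2_diff)
  moreover have "(sqrt (f m))\<^sup>2 = f m"
    using m t f0[of m] by simp
  moreover have "f t \<le> f m"
    using t by (intro max) simp
  ultimately show ?thesis
    unfolding A_def by linarith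
qed

section \<open>The discrete solution and the derivative of its energy\<close>

locale dg_solution =
  fixes r s p q T eps0 c0 :: real
    and mu0 chi1 chi3 :: field
    and k Nx Ny :: nat
    and X Y :: "nat \<Rightarrow> real"
    and E_x E_y H_z J_x J_y :: "real \<Rightarrow> field"
  fixes \<Omega> S U
  defines "\<Omega> \<equiv> {r<..<s} \<times> {p<..<q}" and "S \<equiv> cells Nx X Ny Y" and "U \<equiv> U_h k Nx X Ny Y"
  assumes rs: "r < s" and pq: "p < q" and T: "T > 0" and eps0: "eps0 > 0" and c0: "c0 > 0"
    and pos: "\<forall>z\<in>\<Omega>. 0 < mu0 z \<and> 0 < chi1 z \<and> 0 < chi3 z"
    and mu0: "mu0 \<in> L_infty_on \<Omega>" and chi1: "chi1 \<in> L_infty_on \<Omega>" and chi3: "chi3 \<in> L_infty_on \<Omega>"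
    and X: "grid r s Nx X" and Y: "grid p q Ny Y"
    and J_x: "J_x \<in> C_time 0 T S U" and J_y: "J_y \<in> C_time 0 T S U"
    and E_x: "E_x \<in> C_time 1 T S U" and E_y: "E_y \<in> C_time 1 T S U" and H_z: "H_z \<in> C_time 1 T S U"
    and scheme: "dg_scheme k Nx X Ny Y T eps0 mu0 chi1 chi3 c0 J_x J_y E_x E_y H_z"
begin

text \<open>\<open>c0 * inflow t\<close> is the power removed by the penalties in the fluxes on the
  lines \<open>y = p\<close> and \<open>x = r\<close>; the time integral of \<open>inflow\<close> is
  the one that enters the energy.\<close>

definition inflow :: "real \<Rightarrow> real" where
  "inflow t = (LINT x:{r<..<s}|lebesgue. (yplus (E_x t) x p)\<^sup>2) + (LINT y:{p<..<q}|lebesgue. (xplus (E_y t) r y)\<^sup>2)"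

lemma S_subset: "S \<subseteq> \<Omega>"
  using lines_subset[OF X] lines_subset[OF Y] by (auto simp: S_def \<Omega>_def cells_eq_Times)

lemma negligible_diff: "negligible (\<Omega> - S)"
  unfolding \<Omega>_def S_def by (rule negligible_cells[OF X Y])

lemma S_sets: "S \<in> sets lebesgue"
  using open_cells unfolding S_def by (intro sets_completionI_sets) (simp add: borel_open)

lemma Omega_lmeasurable: "\<Omega> \<in> lmeasurable"
  unfolding \<Omega>_def by (intro lmeasurable_open bounded_Times open_Times) auto

lemma L_infty_integrable: "f \<in> L_infty_on \<Omega> \<Longrightarrow> set_integrable lebesgue S f"
  using L_infty_on_integrable[OF _ Omega_lmeasurable] set_integrable_subset[OF _ S_sets S_subset] by blast

lemma one_integrable: "set_integrable lebesgue S (\<lambda>z. 1 :: real)"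
  by (rule L_infty_integrable) (auto simp: L_infty_on_def)

text \<open>The weight of the source norm is bounded by \<open>inverse eps0\<close>, because
  \<open>chi1\<close> is positive; the other weights are bounded by assumption on a set of finite
  measure.\<close>

lemma weight_integrable:
  "set_integrable lebesgue S (\<lambda>z. eps0 * (1 + chi1 z))"
  "set_integrable lebesgue S mu0"
  "set_integrable lebesgue S (\<lambda>z. eps0 * chi3 z)"
  "set_integrable lebesgue S (\<lambda>z. inverse (eps0 * (1 + chi1 z)))"
proof -
  show "set_integrable lebesgue S (\<lambda>z. eps0 * (1 + chi1 z))"
    by (intro set_integrable_mult_right set_integral_add L_infty_integrable chi1 one_integrable)
  show "set_integrable lebesgue S mu0" "set_integrable lebesgue S (\<lambda>z. eps0 * chi3 z)"
    by (intro set_integrable_mult_right L_infty_integrable mu0 chi3)+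
  have "inverse (eps0 * (1 + chi1 z)) \<le> inverse eps0" "0 \<le> inverse (eps0 * (1 + chi1 z))" if "z \<in> \<Omega>" for z
  proof -
    have "0 < chi1 z"
      using pos that by blast
    then have "eps0 \<le> eps0 * (1 + chi1 z)"
      using eps0 by simp
    from le_imp_inverse_le[OF this eps0] order_trans[OF less_imp_le[OF eps0] this]
    show "inverse (eps0 * (1 + chi1 z)) \<le> inverse eps0" "0 \<le> inverse (eps0 * (1 + chi1 z))"
      by (simp_all only: inverse_nonnegative_iff_nonnegative)
  qed
  then have "AE z in lebesgue_on \<Omega>. \<bar>inverse (eps0 * (1 + chi1 z))\<bar> \<le> inverse eps0"
    by (intro AE_I2) simp
  moreover have "(\<lambda>z. inverse (eps0 * (1 + chi1 z))) \<in> borel_measurable (lebesgue_on \<Omega>)"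
    using chi1 by (intro borel_measurable_inverse borel_measurable_times borel_measurable_add borel_measurable_const)
      (simp add: L_infty_on_def)
  ultimately show "set_integrable lebesgue S (\<lambda>z. inverse (eps0 * (1 + chi1 z)))"
    by (intro L_infty_integrable) (auto simp: L_infty_on_def)
qed

text \<open>In HOL the square of \<open>sqrt x\<close> is \<open>\<bar>x\<bar>\<close>, so squaring
  a weighted norm returns its integral only once that integral is known to be nonnegative.\<close>

lemma wnorm_power2:
  fixes v :: "real \<times> real \<Rightarrow> 'b::real_normed_vector"
  assumes "\<And>z. z \<in> S \<Longrightarrow> w z \<ge> 0"
  shows "(wnorm \<Omega> w v)\<^sup>2 = (LINT z:S|lebesgue. (norm (v z))\<^sup>2 * w z)"
    and "wnorm \<Omega> w v = sqrt (LINT z:S|lebesgue. (norm (v z))\<^sup>2 * w z)"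
proof -
  show 1: "wnorm \<Omega> w v = sqrt (LINT z:S|lebesgue. (norm (v z))\<^sup>2 * w z)"
    unfolding wnorm_def set_lebesgue_integral_null_diff(1)[OF S_subset negligible_diff] ..
  have "(LINT z:S|lebesgue. (norm (v z))\<^sup>2 * w z) \<ge> 0"
    unfolding set_lebesgue_integral_def
    by (rule Bochner_Integration.integral_nonneg) (simp add: assms split: split_indicator)
  then show "(wnorm \<Omega> w v)\<^sup>2 = (LINT z:S|lebesgue. (norm (v z))\<^sup>2 * w z)"
    by (simp add: 1)
qed

lemma weight_pos:
  assumes "z \<in> S"
  shows "0 < eps0 * (1 + chi1 z)" "0 < mu0 z" "0 < eps0 * chi3 z"
proof -
  have "0 < mu0 z" "0 < chi1 z" "0 < chi3 z"
    using pos S_subset assms by auto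
  then show "0 < eps0 * (1 + chi1 z)" "0 < mu0 z" "0 < eps0 * chi3 z"
    using eps0 by simp_all
qed

text \<open>Squares are spelled out as products and the weight is placed last, which is the shape
  that \<open>udiff_mult\<close> and the lemmas on weighted integrals act upon.\<close>

lemma wnorms_power2:
  "(wnorm \<Omega> (\<lambda>z. eps0 * (1 + chi1 z)) (\<lambda>z. (a z, b z)))\<^sup>2
    = (LINT z:S|lebesgue. (a z * a z + b z * b z) * (eps0 * (1 + chi1 z)))"
  "(wnorm \<Omega> mu0 h)\<^sup>2 = (LINT z:S|lebesgue. (h z * h z) * mu0 z)"
  "(wnorm \<Omega> (\<lambda>z. eps0 * chi3 z) (\<lambda>z. (a z)\<^sup>2 + (b z)\<^sup>2))\<^sup>2
    = (LINT z:S|lebesgue. (a z * a z + b z * b z) * (a z * a z + b z * b z) * (eps0 * chi3 z))"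
  "wnorm \<Omega> (\<lambda>z. inverse (eps0 * (1 + chi1 z))) (\<lambda>z. (a z, b z))
    = sqrt (LINT z:S|lebesgue. (a z * a z + b z * b z) * inverse (eps0 * (1 + chi1 z)))"
  for a b h :: field
proof -
  have n: "(norm (a z, b z))\<^sup>2 = a z * a z + b z * b z" "(norm (h z))\<^sup>2 = h z * h z"
    "(norm ((a z)\<^sup>2 + (b z)\<^sup>2))\<^sup>2 = (a z * a z + b z * b z) * (a z * a z + b z * b z)" for z
    by (simp_all add: norm_Pair power2_eq_square)
  show "(wnorm \<Omega> (\<lambda>z. eps0 * (1 + chi1 z)) (\<lambda>z. (a z, b z)))\<^sup>2
    = (LINT z:S|lebesgue. (a z * a z + b z * b z) * (eps0 * (1 + chi1 z)))"
    by (subst wnorm_power2(1)) (simp_all only: n weight_pos less_imp_le)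
  show "(wnorm \<Omega> mu0 h)\<^sup>2 = (LINT z:S|lebesgue. (h z * h z) * mu0 z)"
    by (subst wnorm_power2(1)) (simp_all only: n weight_pos less_imp_le)
  show "(wnorm \<Omega> (\<lambda>z. eps0 * chi3 z) (\<lambda>z. (a z)\<^sup>2 + (b z)\<^sup>2))\<^sup>2
    = (LINT z:S|lebesgue. (a z * a z + b z * b z) * (a z * a z + b z * b z) * (eps0 * chi3 z))"
    by (subst wnorm_power2(1)) (simp_all only: n weight_pos less_imp_le)
  show "wnorm \<Omega> (\<lambda>z. inverse (eps0 * (1 + chi1 z))) (\<lambda>z. (a z, b z))
    = sqrt (LINT z:S|lebesgue. (a z * a z + b z * b z) * inverse (eps0 * (1 + chi1 z)))"
    by (subst wnorm_power2(2)) (simp_all only: n weight_pos less_imp_le inverse_positive_iff_positive)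
qed

lemma energy_eq:
  "energy r s p q eps0 mu0 chi1 chi3 c0 E_x E_y H_z t =
    (LINT z:S|lebesgue. (E_x t z * E_x t z + E_y t z * E_y t z) * (eps0 * (1 + chi1 z)))
    + (LINT z:S|lebesgue. (H_z t z * H_z t z) * mu0 z)
    + 3 / 2 * (LINT z:S|lebesgue. (E_x t z * E_x t z + E_y t z * E_y t z)
        * (E_x t z * E_x t z + E_y t z * E_y t z) * (eps0 * chi3 z))
    + 2 * c0 * (LINT \<tau>:{0..t}|lebesgue. inflow \<tau>)"
  unfolding energy_def Let_def \<Omega>_def[symmetric] wnorms_power2 inflow_def[abs_def] ..

lemma members:
  assumes "t \<in> {0..T}"
  shows "E_x t \<in> U" "E_y t \<in> U" "H_z t \<in> U" "J_x t \<in> U" "J_y t \<in> U"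
  using C_time_1_D(1)[OF E_x[unfolded S_def U_def] T] C_time_1_D(1)[OF E_y[unfolded S_def U_def] T]
    C_time_1_D(1)[OF H_z[unfolded S_def U_def] T] C_time_0_D(1)[OF J_x[unfolded S_def U_def]]
    C_time_0_D(1)[OF J_y[unfolded S_def U_def]] assms
  unfolding U_def by blast+

lemma udiffs: "udiff T S E_x (dt T E_x)" "udiff T S E_y (dt T E_y)" "udiff T S H_z (dt T H_z)"
  using C_time_1_D(2)[OF E_x[unfolded S_def U_def] T] C_time_1_D(2)[OF E_y[unfolded S_def U_def] T]
    C_time_1_D(2)[OF H_z[unfolded S_def U_def] T]
  unfolding S_def by simp_all

lemma uconts: "ucont T S E_x" "ucont T S E_y" "ucont T S J_x" "ucont T S J_y"
  using udiff_imp_ucont[OF udiffs(1)] udiff_imp_ucont[OF udiffs(2)]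
    C_time_0_D(2)[OF J_x[unfolded S_def U_def]] C_time_0_D(2)[OF J_y[unfolded S_def U_def]]
  unfolding S_def by simp_all

lemma continuous_inflow: "continuous_on {0..T} inflow"
  unfolding inflow_def[abs_def]
  by (rule continuous_on_add[OF
        yplus_integral_continuous[OF X Y pq C_time_1_D(1)[OF E_x[unfolded S_def U_def] T] uconts(1)[unfolded S_def]]
        xplus_integral_continuous[OF X Y rs C_time_1_D(1)[OF E_y[unfolded S_def U_def] T] uconts(2)[unfolded S_def]]])

lemma inflow_nonneg: "inflow t \<ge> 0"
  unfolding inflow_def set_lebesgue_integral_def
  by (intro add_nonneg_nonneg Bochner_Integration.integral_nonneg) simp_all

lemma balance_on_cells:
  assumes t: "t \<in> {0..T}"
  shows "(\<Sum>i\<in>{1..Nx}. \<Sum>j\<in>{1..Ny}.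
      (LINT z:cell X Y i j|lebesgue. dtD eps0 chi1 chi3 (E_x t) (E_y t) (dt T E_x t) (dt T E_y t) z * E_x t z)
      + (LINT z:cell X Y i j|lebesgue. dtD eps0 chi1 chi3 (E_y t) (E_x t) (dt T E_y t) (dt T E_x t) z * E_y t z)
      + (LINT z:cell X Y i j|lebesgue. mu0 z * dt T H_z t z * H_z t z))
    = (\<Sum>i\<in>{1..Nx}. \<Sum>j\<in>{1..Ny}.
      (LINT z:cell X Y i j|lebesgue. J_x t z * E_x t z) + (LINT z:cell X Y i j|lebesgue. J_y t z * E_y t z))
      - c0 * inflow t" (is "(\<Sum>i\<in>_. \<Sum>j\<in>_. ?D i j) = (\<Sum>i\<in>_. \<Sum>j\<in>_. ?J i j) - _")
proof -
  note mem = members[OF t, unfolded U_def]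
  define HF where "HF i j =
      - (LINT x:{X (i - 1)<..<X i}|lebesgue. H_z_hat_y c0 Y (H_z t) (E_x t) j x * yminus (E_x t) x (Y j)
           - H_z_hat_y c0 Y (H_z t) (E_x t) (j - 1) x * yplus (E_x t) x (Y (j - 1)))
      + (LINT z:cell X Y i j|lebesgue. H_z t z * dy (E_x t) z)
      - (LINT x:{X (i - 1)<..<X i}|lebesgue. E_x_hat Ny Y (E_x t) j x * yminus (H_z t) x (Y j)
           - E_x_hat Ny Y (E_x t) (j - 1) x * yplus (H_z t) x (Y (j - 1)))
      + (LINT z:cell X Y i j|lebesgue. E_x t z * dy (H_z t) z)" for i j
  define VF where "VF i j =
      - (LINT y:{Y (j - 1)<..<Y j}|lebesgue. H_z_hat_x c0 X (H_z t) (E_y t) i y * xminus (E_y t) (X i) y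
           - H_z_hat_x c0 X (H_z t) (E_y t) (i - 1) y * xplus (E_y t) (X (i - 1)) y)
      + (LINT z:cell X Y i j|lebesgue. H_z t z * dx (E_y t) z)
      - (LINT y:{Y (j - 1)<..<Y j}|lebesgue. E_y_hat Nx X (E_y t) i y * xminus (H_z t) (X i) y
           - E_y_hat Nx X (E_y t) (i - 1) y * xplus (H_z t) (X (i - 1)) y)
      + (LINT z:cell X Y i j|lebesgue. E_y t z * dx (H_z t) z)" for i j
  \<comment> \<open>The opposite signs of \<open>HF\<close> and \<open>VF\<close> are those of the
    two components of the curl. They are matched by the opposite signs of the penalties in the two
    fluxes of \<open>H_z\<close>, so that both boundary lines dissipate.\<close>
  have "?D i j = ?J i j - HF i j + VF i j" if i: "i \<in> {1..Nx}" and j: "j \<in> {1..Ny}" for i j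
  proof -
    note eqs = bspec[OF bspec[OF bspec[OF bspec[OF bspec[OF bspec[OF scheme[unfolded dg_scheme_def] t] i] j]
          mem(1)] mem(2)] mem(3), unfolded Let_def]
    show ?thesis
      unfolding HF_def VF_def using eqs[THEN conjunct1] eqs[THEN conjunct2, THEN conjunct1]
        eqs[THEN conjunct2, THEN conjunct2] by linarith
  qed
  then have "(\<Sum>i\<in>{1..Nx}. \<Sum>j\<in>{1..Ny}. ?D i j) = (\<Sum>i\<in>{1..Nx}. \<Sum>j\<in>{1..Ny}. ?J i j - HF i j + VF i j)"
    by (intro sum.cong refl) blast
  also have "\<dots> = (\<Sum>i\<in>{1..Nx}. \<Sum>j\<in>{1..Ny}. ?J i j) - (\<Sum>i\<in>{1..Nx}. \<Sum>j\<in>{1..Ny}. HF i j)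
      + (\<Sum>i\<in>{1..Nx}. \<Sum>j\<in>{1..Ny}. VF i j)"
    by (simp only: sum.distrib sum_subtractf)
  also have "(\<Sum>i\<in>{1..Nx}. \<Sum>j\<in>{1..Ny}. HF i j) = c0 * (LINT x:{r<..<s}|lebesgue. (yplus (E_x t) x p)\<^sup>2)"
    unfolding HF_def by (rule horizontal_flux_sum[OF X Y pq mem(1,3)])
  also have "(\<Sum>i\<in>{1..Nx}. \<Sum>j\<in>{1..Ny}. VF i j) = - c0 * (LINT y:{p<..<q}|lebesgue. (xplus (E_y t) r y)\<^sup>2)"
    unfolding VF_def by (rule vertical_flux_sum[OF X Y rs mem(2,3)])
  finally show ?thesis
    by (simp add: inflow_def distrib_left)
qed

text \<open>The power supplied by the current. The factor 1 is the constant weight that makes the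
  expression an instance of the weighted integrals.\<close>

definition work :: "real \<Rightarrow> real" where
  "work t = (LINT z:S|lebesgue. (J_x t z * E_x t z + J_y t z * E_y t z) * 1)"

lemma integral_S:
  fixes f :: field
  assumes "set_integrable lebesgue S f"
  shows "(LINT z:S|lebesgue. f z) = (\<Sum>i\<in>{1..Nx}. \<Sum>j\<in>{1..Ny}. LINT z:cell X Y i j|lebesgue. f z)"
  using integral_cells[OF X Y assms[unfolded S_def]] unfolding S_def .

lemma power_balance:
  assumes t: "t \<in> {0..T}"
  defines "a \<equiv> \<lambda>z. dtD eps0 chi1 chi3 (E_x t) (E_y t) (dt T E_x t) (dt T E_y t) z * E_x t z"
    and "b \<equiv> \<lambda>z. dtD eps0 chi1 chi3 (E_y t) (E_x t) (dt T E_y t) (dt T E_x t) z * E_y t z"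
    and "m \<equiv> \<lambda>z. mu0 z * dt T H_z t z * H_z t z"
  shows "set_integrable lebesgue S a" "set_integrable lebesgue S b" "set_integrable lebesgue S m"
    and "(LINT z:S|lebesgue. a z) + (LINT z:S|lebesgue. b z) + (LINT z:S|lebesgue. m z) = work t - c0 * inflow t"
proof -
  have bm: "bmeas S (E_x t)" "bmeas S (E_y t)" "bmeas S (H_z t)"
    "bmeas S (dt T E_x t)" "bmeas S (dt T E_y t)" "bmeas S (dt T H_z t)" "bmeas S (J_x t)" "bmeas S (J_y t)"
    using udiffs uconts t by (simp_all add: udiff_def ucont_def)
  \<comment> \<open>The tested displacement is regrouped into bounded measurable factors times the
    two integrable weights. Exchanging the roles of \<open>A\<close> and \<open>B\<close> covers
    both components.\<close>
  have D: "set_integrable lebesgue S (\<lambda>z. dtD eps0 chi1 chi3 A B A' B' z * A z)"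
    if A: "bmeas S A" "bmeas S B" "bmeas S A'" "bmeas S B'" for A B A' B'
  proof -
    have "set_integrable lebesgue S (\<lambda>z. (A' z * A z) * (eps0 * (1 + chi1 z))
        + (((A z * A z + B z * B z) * A' z + 2 * (A z * A z) * A' z + 2 * A z * B z * B' z) * A z) * (eps0 * chi3 z))"
      by (intro set_integral_add bmeas_weighted_integrable bmeas_add bmeas_mult bmeas_const A weight_integrable S_sets)
    moreover have "dtD eps0 chi1 chi3 A B A' B' z * A z = (A' z * A z) * (eps0 * (1 + chi1 z))
        + (((A z * A z + B z * B z) * A' z + 2 * (A z * A z) * A' z + 2 * A z * B z * B' z) * A z) * (eps0 * chi3 z)" for z
      by (simp add: dtD_def power2_eq_square algebra_simps)
    ultimately show ?thesis
      by (simp only:)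
  qed
  show a: "set_integrable lebesgue S a" and b: "set_integrable lebesgue S b"
    unfolding a_def b_def by (intro D bm)+
  have "set_integrable lebesgue S (\<lambda>z. (dt T H_z t z * H_z t z) * mu0 z)"
    by (intro bmeas_weighted_integrable bmeas_mult bm weight_integrable S_sets)
  then show m: "set_integrable lebesgue S m"
    unfolding m_def by (simp only: mult.assoc mult.commute[of "mu0 _"])
  have J: "set_integrable lebesgue S (\<lambda>z. J_x t z * E_x t z * 1)" "set_integrable lebesgue S (\<lambda>z. J_y t z * E_y t z * 1)"
    by (intro bmeas_weighted_integrable bmeas_mult bm one_integrable S_sets)+
  then have J': "set_integrable lebesgue S (\<lambda>z. J_x t z * E_x t z)" "set_integrable lebesgue S (\<lambda>z. J_y t z * E_y t z)"
    by simp_all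
  have "(LINT z:S|lebesgue. a z) + (LINT z:S|lebesgue. b z) + (LINT z:S|lebesgue. m z)
      = (\<Sum>i\<in>{1..Nx}. \<Sum>j\<in>{1..Ny}. (LINT z:cell X Y i j|lebesgue. a z)
         + (LINT z:cell X Y i j|lebesgue. b z) + (LINT z:cell X Y i j|lebesgue. m z))"
    by (simp only: integral_S[OF a] integral_S[OF b] integral_S[OF m] sum.distrib)
  also have "\<dots> = (\<Sum>i\<in>{1..Nx}. \<Sum>j\<in>{1..Ny}.
      (LINT z:cell X Y i j|lebesgue. J_x t z * E_x t z) + (LINT z:cell X Y i j|lebesgue. J_y t z * E_y t z))
      - c0 * inflow t"
    unfolding a_def b_def m_def by (rule balance_on_cells[OF t])
  also have "(\<Sum>i\<in>{1..Nx}. \<Sum>j\<in>{1..Ny}.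
      (LINT z:cell X Y i j|lebesgue. J_x t z * E_x t z) + (LINT z:cell X Y i j|lebesgue. J_y t z * E_y t z))
      = (LINT z:S|lebesgue. J_x t z * E_x t z) + (LINT z:S|lebesgue. J_y t z * E_y t z)"
    by (simp only: integral_S[OF J'(1)] integral_S[OF J'(2)] sum.distrib)
  also have "\<dots> = work t"
    unfolding work_def using J' by (simp add: set_integral_add)
  finally show "(LINT z:S|lebesgue. a z) + (LINT z:S|lebesgue. b z) + (LINT z:S|lebesgue. m z) = work t - c0 * inflow t" .
qed

lemma energy_has_derivative:
  assumes t: "t \<in> {0..T}"
  shows "(energy r s p q eps0 mu0 chi1 chi3 c0 E_x E_y H_z has_real_derivative 2 * work t) (at t within {0..T})"
proof -
  let ?Q = "\<lambda>t z. E_x t z * E_x t z + E_y t z * E_y t z"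
  let ?Q' = "\<lambda>t z. (dt T E_x t z * E_x t z + E_x t z * dt T E_x t z) + (dt T E_y t z * E_y t z + E_y t z * dt T E_y t z)"
  let ?H' = "\<lambda>t z. dt T H_z t z * H_z t z + H_z t z * dt T H_z t z"
  let ?R' = "\<lambda>t z. ?Q' t z * ?Q t z + ?Q t z * ?Q' t z"
  let ?w1 = "\<lambda>z. eps0 * (1 + chi1 z)" and ?w3 = "\<lambda>z. eps0 * chi3 z"
  let ?I = "\<lambda>f. LINT z:S|lebesgue. f z"
  define a b m where "a = (\<lambda>z. dtD eps0 chi1 chi3 (E_x t) (E_y t) (dt T E_x t) (dt T E_y t) z * E_x t z)"
    and "b = (\<lambda>z. dtD eps0 chi1 chi3 (E_y t) (E_x t) (dt T E_y t) (dt T E_x t) z * E_y t z)"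
    and "m = (\<lambda>z. mu0 z * dt T H_z t z * H_z t z)"
  have Q: "udiff T S ?Q ?Q'"
    by (intro udiff_add udiff_mult udiffs)
  have H: "udiff T S (\<lambda>t z. H_z t z * H_z t z) ?H'"
    by (intro udiff_mult udiffs)
  have R: "udiff T S (\<lambda>t z. ?Q t z * ?Q t z) ?R'"
    by (rule udiff_mult[OF Q Q])
  have B: "((\<lambda>t. LINT \<tau>:{0..t}|lebesgue. inflow \<tau>) has_real_derivative inflow t) (at t within {0..T})"
  \<comment> \<open>The gauge and the Lebesgue integral of the continuous function
    \<open>inflow\<close> agree throughout \<open>{0..T}\<close>, so the radius 1 is an arbitrary
    choice.\<close>
  proof (rule has_field_derivative_transform_within[OF _ zero_less_one t])
    show "((\<lambda>t. integral {0..t} inflow) has_real_derivative inflow t) (at t within {0..T})"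
      unfolding has_real_derivative_iff_has_vector_derivative
      by (rule integral_has_vector_derivative[OF continuous_inflow t])
    show "integral {0..\<tau>} inflow = (LINT \<tau>:{0..\<tau>}|lebesgue. inflow \<tau>)" if "\<tau> \<in> {0..T}" for \<tau>
      by (rule set_lebesgue_integral_eq_integral(2)[symmetric], rule absolutely_integrable_continuous_real,
          rule continuous_on_subset[OF continuous_inflow]) (use that in auto)
  qed
  have i: "set_integrable lebesgue S (\<lambda>z. ?Q' t z * ?w1 z)" "set_integrable lebesgue S (\<lambda>z. ?H' t z * mu0 z)"
    "set_integrable lebesgue S (\<lambda>z. ?R' t z * ?w3 z)"
    using Q H R t by (simp_all add: udiff_def bmeas_weighted_integrable weight_integrable S_sets)
  note pb = power_balance[OF t, folded a_def b_def m_def]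
  have "?I (\<lambda>z. ?Q' t z * ?w1 z) + ?I (\<lambda>z. ?H' t z * mu0 z) + 3 / 2 * ?I (\<lambda>z. ?R' t z * ?w3 z)
      = ?I (\<lambda>z. ?Q' t z * ?w1 z + ?H' t z * mu0 z + 3 / 2 * (?R' t z * ?w3 z))"
    by (simp only: set_integral_mult_right[symmetric] set_integral_add(2)[symmetric] set_integral_add(1)
        set_integrable_mult_right i)
  \<comment> \<open>A pointwise identity. Since \<open>?R'\<close> is
    \<open>4 \<bar>E\<bar>\<^sup>2 E . E'\<close>, the factor \<open>3 / 2\<close> yields
    \<open>6 \<bar>E\<bar>\<^sup>2 E . E'\<close>, exactly twice the nonlinear part of the tested
    displacement; this fixes the coefficient of the quartic term in the energy.\<close>
  also have "\<dots> = ?I (\<lambda>z. 2 * (a z + b z + m z))"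
    by (rule arg_cong[of _ _ ?I])
      (simp add: a_def b_def m_def dtD_def fun_eq_iff power2_eq_square algebra_simps)
  also have "\<dots> = 2 * (work t - c0 * inflow t)"
    by (simp only: set_integral_mult_right set_integral_add(2) set_integral_add(1) pb)
  finally have "?I (\<lambda>z. ?Q' t z * ?w1 z) + ?I (\<lambda>z. ?H' t z * mu0 z) + 3 / 2 * ?I (\<lambda>z. ?R' t z * ?w3 z)
      + 2 * c0 * inflow t = 2 * work t"
    by (simp add: algebra_simps)
  moreover have "((\<lambda>t. ?I (\<lambda>z. ?Q t z * ?w1 z) + ?I (\<lambda>z. (H_z t z * H_z t z) * mu0 z)
      + 3 / 2 * ?I (\<lambda>z. ?Q t z * ?Q t z * ?w3 z) + 2 * c0 * (LINT \<tau>:{0..t}|lebesgue. inflow \<tau>))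
    has_real_derivative ?I (\<lambda>z. ?Q' t z * ?w1 z) + ?I (\<lambda>z. ?H' t z * mu0 z) + 3 / 2 * ?I (\<lambda>z. ?R' t z * ?w3 z)
      + 2 * c0 * inflow t) (at t within {0..T})"
    by (intro DERIV_add DERIV_cmult B udiff_weighted_integral_derivative[OF Q weight_integrable(1) S_sets t]
        udiff_weighted_integral_derivative[OF H weight_integrable(2) S_sets t]
        udiff_weighted_integral_derivative[OF R weight_integrable(3) S_sets t])
  ultimately show ?thesis
    by (simp only: energy_eq[abs_def])
qed

section \<open>Control of the work by the energy\<close>

lemma weighted_integral_nonneg:
  fixes f w :: field
  assumes "\<And>z. 0 \<le> f z" "\<And>z. z \<in> S \<Longrightarrow> 0 < w z"
  shows "0 \<le> (LINT z:S|lebesgue. f z * w z)"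
  unfolding set_lebesgue_integral_def
  by (rule Bochner_Integration.integral_nonneg) (simp add: assms less_imp_le split: split_indicator)

lemma electric_le_energy:
  shows "0 \<le> (LINT z:S|lebesgue. (E_x t z * E_x t z + E_y t z * E_y t z) * (eps0 * (1 + chi1 z)))"
    and "(LINT z:S|lebesgue. (E_x t z * E_x t z + E_y t z * E_y t z) * (eps0 * (1 + chi1 z)))
      \<le> energy r s p q eps0 mu0 chi1 chi3 c0 E_x E_y H_z t"
proof -
  show "0 \<le> (LINT z:S|lebesgue. (E_x t z * E_x t z + E_y t z * E_y t z) * (eps0 * (1 + chi1 z)))"
    by (rule weighted_integral_nonneg) (simp_all only: weight_pos sum_squares_ge_zero)
  have "0 \<le> (LINT z:S|lebesgue. (H_z t z * H_z t z) * mu0 z)"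
    by (rule weighted_integral_nonneg) (simp_all only: weight_pos zero_le_square)
  moreover have "0 \<le> (LINT z:S|lebesgue. (E_x t z * E_x t z + E_y t z * E_y t z)
        * (E_x t z * E_x t z + E_y t z * E_y t z) * (eps0 * chi3 z))"
    by (rule weighted_integral_nonneg) (simp_all only: weight_pos zero_le_square)
  moreover have "0 \<le> 2 * c0 * (LINT \<tau>:{0..t}|lebesgue. inflow \<tau>)"
    unfolding set_lebesgue_integral_def using c0 inflow_nonneg
    by (intro mult_nonneg_nonneg Bochner_Integration.integral_nonneg) simp_all
  ultimately show "(LINT z:S|lebesgue. (E_x t z * E_x t z + E_y t z * E_y t z) * (eps0 * (1 + chi1 z)))
      \<le> energy r s p q eps0 mu0 chi1 chi3 c0 E_x E_y H_z t"
    unfolding energy_eq by linarith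
qed

lemma source_norm_nonneg:
  "0 \<le> wnorm \<Omega> (\<lambda>z. inverse (eps0 * (1 + chi1 z))) (\<lambda>z. (a z, b z))" for a b :: field
proof -
  have "0 \<le> (LINT z:S|lebesgue. (a z * a z + b z * b z) * inverse (eps0 * (1 + chi1 z)))"
    by (rule weighted_integral_nonneg)
      (simp_all only: weight_pos inverse_positive_iff_positive sum_squares_ge_zero)
  then show ?thesis
    unfolding wnorms_power2 by simp
qed

text \<open>The weights of \<open>J\<close> and \<open>E\<close> are inverse to each other, so
  Cauchy-Schwarz bounds the work by the source norm times the linear electric part of the energy;
  all other parts of the energy are nonnegative.\<close>

lemma work_le:
  assumes t: "t \<in> {0..T}"
  shows "work t \<le> wnorm \<Omega> (\<lambda>z. inverse (eps0 * (1 + chi1 z))) (\<lambda>z. (J_x t z, J_y t z))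
    * sqrt (energy r s p q eps0 mu0 chi1 chi3 c0 E_x E_y H_z t)"
proof -
  let ?w = "\<lambda>z. eps0 * (1 + chi1 z)"
  let ?J = "\<lambda>z. J_x t z * J_x t z + J_y t z * J_y t z" and ?E = "\<lambda>z. E_x t z * E_x t z + E_y t z * E_y t z"
  have bm: "bmeas S (E_x t)" "bmeas S (E_y t)" "bmeas S (J_x t)" "bmeas S (J_y t)"
    using uconts t by (simp_all add: ucont_def)
  have young: "x * y \<le> l / 2 * (x * x * inverse w) + (y * y * w) / (2 * l)" if "l > 0" "w > 0" for x y l w :: real
  proof -
    \<comment> \<open>Expanding this square gives the weighted Young inequality, with the difference
      of its two sides as the value.\<close>
    have "0 \<le> (l * x - w * y)\<^sup>2 / (2 * l * w)"
      using that by simp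
    also have "\<dots> = l / 2 * (x * x * inverse w) + (y * y * w) / (2 * l) - x * y"
      using that by (simp add: power2_eq_square field_simps)
    finally show ?thesis
      by simp
  qed
  have "work t \<le> sqrt (LINT z:S|lebesgue. ?J z * inverse (?w z)) * sqrt (LINT z:S|lebesgue. ?E z * ?w z)"
    unfolding work_def
  proof (rule set_integral_Cauchy_Schwarz)
    show "set_integrable lebesgue S (\<lambda>z. ?J z * inverse (?w z))" "set_integrable lebesgue S (\<lambda>z. ?E z * ?w z)"
      "set_integrable lebesgue S (\<lambda>z. (J_x t z * E_x t z + J_y t z * E_y t z) * 1)"
      by (intro bmeas_weighted_integrable bmeas_add bmeas_mult bm weight_integrable one_integrable S_sets)+
    fix z assume z: "z \<in> S"
    show "0 \<le> ?J z * inverse (?w z)" "0 \<le> ?E z * ?w z"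
      using weight_pos(1)[OF z] by (simp_all only: mult_nonneg_nonneg sum_squares_ge_zero less_imp_le
          inverse_nonnegative_iff_nonnegative)
    fix l :: real assume "l > 0"
    from young[OF this weight_pos(1)[OF z], of "J_x t z" "E_x t z"] young[OF this weight_pos(1)[OF z], of "J_y t z" "E_y t z"]
    show "(J_x t z * E_x t z + J_y t z * E_y t z) * 1 \<le> l / 2 * (?J z * inverse (?w z)) + ?E z * ?w z / (2 * l)"
      by (simp only: distrib_left distrib_right add_divide_distrib mult_1_right)
  qed
  also have "sqrt (LINT z:S|lebesgue. ?J z * inverse (?w z))
      = wnorm \<Omega> (\<lambda>z. inverse (eps0 * (1 + chi1 z))) (\<lambda>z. (J_x t z, J_y t z))"
    by (rule wnorms_power2(4)[symmetric])
  also have "\<dots> * sqrt (LINT z:S|lebesgue. ?E z * ?w z) \<le> \<dots> * sqrt (energy r s p q eps0 mu0 chi1 chi3 c0 E_x E_y H_z t)"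
    using electric_le_energy(2)[of t] by (intro mult_left_mono source_norm_nonneg) simp
  finally show ?thesis .
qed

lemma energy_conserved:
  assumes J: "\<forall>t\<in>{0..T}. \<forall>z\<in>S. J_x t z = 0 \<and> J_y t z = 0" and t: "t \<in> {0..T}"
  shows "energy r s p q eps0 mu0 chi1 chi3 c0 E_x E_y H_z t = energy r s p q eps0 mu0 chi1 chi3 c0 E_x E_y H_z 0"
proof -
  have "work \<tau> = 0" if "\<tau> \<in> {0..T}" for \<tau>
  proof -
    have "work \<tau> = (LINT z:S|lebesgue. 0)"
      unfolding work_def using J that by (intro set_lebesgue_integral_cong[OF S_sets]) simp
    then show ?thesis
      by simp
  qed
  then have "(energy r s p q eps0 mu0 chi1 chi3 c0 E_x E_y H_z has_real_derivative 0) (at \<tau> within {0..T})"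
    if "\<tau> \<in> {0..T}" for \<tau>
    using energy_has_derivative[OF that] that by simp
  then obtain c where "\<forall>\<tau>\<in>{0..T}. energy r s p q eps0 mu0 chi1 chi3 c0 E_x E_y H_z \<tau> = c"
    using has_field_derivative_zero_constant[of "{0..T}"] convex_real_interval(5) by blast
  then show ?thesis
    using t T by simp
qed

lemma energy_initial:
  assumes init: "\<forall>z\<in>S. E_x 0 z = e z \<and> E_y 0 z = f z \<and> H_z 0 z = h z"
  shows "energy r s p q eps0 mu0 chi1 chi3 c0 E_x E_y H_z 0
    = (wnorm \<Omega> (\<lambda>z. eps0 * (1 + chi1 z)) (\<lambda>z. (e z, f z)))\<^sup>2 + (wnorm \<Omega> mu0 h)\<^sup>2
      + 3 / 2 * (wnorm \<Omega> (\<lambda>z. eps0 * chi3 z) (\<lambda>z. (e z)\<^sup>2 + (f z)\<^sup>2))\<^sup>2"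
proof -
  let ?I = "\<lambda>g. LINT z:S|lebesgue. g z"
  \<comment> \<open>A single instant is a null set, so the penalty integral contributes nothing at
    time 0.\<close>
  have "(LINT \<tau>:{0..0}|lebesgue. inflow \<tau>) = (LINT \<tau>:{}|lebesgue. inflow \<tau>)"
    by (rule set_lebesgue_integral_null_diff(1)) simp_all
  then have "(LINT \<tau>:{0..0}|lebesgue. inflow \<tau>) = 0"
    by (simp add: set_lebesgue_integral_def)
  moreover have "?I (\<lambda>z. (E_x 0 z * E_x 0 z + E_y 0 z * E_y 0 z) * (eps0 * (1 + chi1 z)))
      = ?I (\<lambda>z. (e z * e z + f z * f z) * (eps0 * (1 + chi1 z)))"
    using init by (intro set_lebesgue_integral_cong[OF S_sets]) simp
  moreover have "?I (\<lambda>z. H_z 0 z * H_z 0 z * mu0 z) = ?I (\<lambda>z. h z * h z * mu0 z)"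
    using init by (intro set_lebesgue_integral_cong[OF S_sets]) simp
  moreover have "?I (\<lambda>z. (E_x 0 z * E_x 0 z + E_y 0 z * E_y 0 z) * (E_x 0 z * E_x 0 z + E_y 0 z * E_y 0 z) * (eps0 * chi3 z))
      = ?I (\<lambda>z. (e z * e z + f z * f z) * (e z * e z + f z * f z) * (eps0 * chi3 z))"
    using init by (intro set_lebesgue_integral_cong[OF S_sets]) simp
  ultimately show ?thesis
    unfolding energy_eq wnorms_power2 by (simp only: mult_zero_right add_0_right)
qed

lemma continuous_source_norm:
  "continuous_on {0..T} (\<lambda>\<tau>. wnorm \<Omega> (\<lambda>z. inverse (eps0 * (1 + chi1 z))) (\<lambda>z. (J_x \<tau> z, J_y \<tau> z)))"
  unfolding wnorms_power2
  by (intro continuous_on_real_sqrt ucont_weighted_integral_continuous weight_integrable S_sets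
      ucont_add ucont_mult uconts)

lemma energy_bound:
  assumes t: "t \<in> {0..T}"
  shows "energy r s p q eps0 mu0 chi1 chi3 c0 E_x E_y H_z t
    \<le> 2 * energy r s p q eps0 mu0 chi1 chi3 c0 E_x E_y H_z 0
      + 4 * (LINT \<tau>:{0..t}|lebesgue.
          wnorm \<Omega> (\<lambda>z. inverse (eps0 * (1 + chi1 z))) (\<lambda>z. (J_x \<tau> z, J_y \<tau> z)))\<^sup>2"
proof -
  let ?N = "\<lambda>\<tau>. wnorm \<Omega> (\<lambda>z. inverse (eps0 * (1 + chi1 z))) (\<lambda>z. (J_x \<tau> z, J_y \<tau> z))"
  have "{0..t} \<subseteq> {0..T}"
    using t by auto
  from set_lebesgue_integral_eq_integral(2)[OF absolutely_integrable_continuous_real[OF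
        continuous_on_subset[OF continuous_source_norm this]]]
  have "(LINT \<tau>:{0..t}|lebesgue. ?N \<tau>) = integral {0..t} ?N" .
  then show ?thesis
    using energy_growth_bound[OF energy_has_derivative continuous_source_norm source_norm_nonneg work_le
        order_trans[OF electric_le_energy] t] by simp
qed

end

theorem theorem4p1:
  fixes r s p q T eps0 c0 :: real
    and mu0 chi1 chi3 E_x0 E_y0 H_z0 :: field
    and k Nx Ny :: nat
    and X Y :: "nat \<Rightarrow> real"
    and E_x E_y H_z J_x J_y :: "real \<Rightarrow> field"
  defines "\<Omega> \<equiv> {r<..<s} \<times> {p<..<q}"
    and "S \<equiv> cells Nx X Ny Y"
    and "U \<equiv> U_h k Nx X Ny Y"
    and "En \<equiv> energy r s p q eps0 mu0 chi1 chi3 c0 E_x E_y H_z"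
  assumes "r < s" and "p < q" and "T > 0" and "eps0 > 0" and "c0 > 0"
    and "\<forall>z\<in>\<Omega>. 0 < mu0 z \<and> 0 < chi1 z \<and> 0 < chi3 z"
    and "mu0 \<in> L_infty_on \<Omega>" and "chi1 \<in> L_infty_on \<Omega>" and "chi3 \<in> L_infty_on \<Omega>"
    and "grid r s Nx X" and "grid p q Ny Y"
    and "E_x0 \<in> U" and "E_y0 \<in> U" and "H_z0 \<in> U"
    and "J_x \<in> C_time 0 T S U" and "J_y \<in> C_time 0 T S U"
    and "E_x \<in> C_time 1 T S U" and "E_y \<in> C_time 1 T S U" and "H_z \<in> C_time 1 T S U"
    and "dg_scheme k Nx X Ny Y T eps0 mu0 chi1 chi3 c0 J_x J_y E_x E_y H_z"
    and "\<forall>z\<in>S. E_x 0 z = E_x0 z \<and> E_y 0 z = E_y0 z \<and> H_z 0 z = H_z0 z"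
  shows
    "((\<forall>t\<in>{0..T}. \<forall>z\<in>S. J_x t z = 0 \<and> J_y t z = 0) \<longrightarrow>
       (\<forall>t\<in>{0..<T}. En t = En 0 \<and>
          En 0 = (wnorm \<Omega> (\<lambda>z. eps0 * (1 + chi1 z)) (\<lambda>z. (E_x0 z, E_y0 z)))\<^sup>2
            + (wnorm \<Omega> mu0 H_z0)\<^sup>2
            + 3 / 2 * (wnorm \<Omega> (\<lambda>z. eps0 * chi3 z) (\<lambda>z. (E_x0 z)\<^sup>2 + (E_y0 z)\<^sup>2))\<^sup>2)) \<and>
     (\<forall>t\<in>{0..<T}. En t \<le> 2 * En 0
          + 8 * (LINT \<tau>:{0..t}|lebesgue.
                   wnorm \<Omega> (\<lambda>z. inverse (eps0 * (1 + chi1 z))) (\<lambda>z. (J_x \<tau> z, J_y \<tau> z)))\<^sup>2)"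
proof -
  interpret dg_solution r s p q T eps0 c0 mu0 chi1 chi3 k Nx Ny X Y E_x E_y H_z J_x J_y \<Omega> S U
    by unfold_locales (use assms in simp_all)
  have 1: "En t = En 0" if "\<forall>t\<in>{0..T}. \<forall>z\<in>S. J_x t z = 0 \<and> J_y t z = 0" "t \<in> {0..<T}" for t
    unfolding En_def using that by (intro energy_conserved) auto
  have 2: "En 0 = (wnorm \<Omega> (\<lambda>z. eps0 * (1 + chi1 z)) (\<lambda>z. (E_x0 z, E_y0 z)))\<^sup>2
      + (wnorm \<Omega> mu0 H_z0)\<^sup>2
      + 3 / 2 * (wnorm \<Omega> (\<lambda>z. eps0 * chi3 z) (\<lambda>z. (E_x0 z)\<^sup>2 + (E_y0 z)\<^sup>2))\<^sup>2"
    unfolding En_def by (rule energy_initial) fact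
  have 3: "En t \<le> 2 * En 0 + 8 * (LINT \<tau>:{0..t}|lebesgue.
      wnorm \<Omega> (\<lambda>z. inverse (eps0 * (1 + chi1 z))) (\<lambda>z. (J_x \<tau> z, J_y \<tau> z)))\<^sup>2" if "t \<in> {0..<T}" for t
  proof -
    have "t \<in> {0..T}"
      using that by simp
    \<comment> \<open>The bound at hand has the constant 4; the constant 8 follows because the
      squared integral is nonnegative.\<close>
    from energy_bound[OF this] show ?thesis
      unfolding En_def by (rule order_trans) simp
  qed
  show ?thesis
    using 1 2 3 by simp
qed

end
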